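(* Let $S\ge 2$ and $p\in\{1,\dots,S-1\}$ be integers. Assume that the input is GI/GI, i.e. $(\tau\circ\theta^n)_{n\in\mathbb Z}$ and $(\sigma\circ\theta^n)_{n\in\mathbb Z}$ are two mutually independent i.i.d. sequences, and that the distribution of $\tau$ has unbounded support. If moreover $$\mathbb E[\sigma]\,\mathbb P[Z_p>0]<(S-p)\,\mathbb E[\tau]\qquad\text{and}\qquad \mathbb P[Z_p=0]>0,$$ then the equation $$W^p\circ\theta=G^p(W^p)\quad\text{a.s.}$$ admits a proper (i.e. a.s. finite) $\overline{(\mathbb R_+)^S}$-valued solution $W^p$ defined on $\Omega$.
   Context: Setting: $(\Omega,\mathcal F,\mathbb P)$ is a probability space and $\theta$ is a bijective bimeasurable map of $\Omega$ that preserves $\mathbb P$ and is ergodic. $\sigma,\tau$ are non-negative integrable random variables on $\Omega$ (service time of customer $0$, and time between the arrivals of customers $0$ and $1$), with $\mathbb P[\tau>0]=1$. Notation: $x^+=\max(x,0)$, applied coordinatewise to vectors. For $u\in\mathbb R^q$, $\bar u$ denotes the vector $u$ with coordinates rearranged in nondecreasing order; $\overline{(\mathbb R_+)^q}$ is the set of vectors of $(\mathbb R_+)^q$ with nondecreasing coordinates. $\mathbf e_i$ is the $i$-th canonical basis vector, $\mathbf 1=(1,\dots,1)$. For $\ell\ge1$, $Z_\ell=\Big[\sup_{k\ge \ell}\Big(\sigma\circ\theta^{-k}-\sum_{i=1}^k\tau\circ\theta^{-i}\Big)\Big]^+$. The random map $G^p:\overline{(\mathbb R_+)^S}\to\overline{(\mathbb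 R_+)^S}$ (driving the ordered workload vector of $S$ parallel queues in which an arriving customer joins a free server if there is one, and otherwise the queue with the $(p+1)$-th smallest workload) is $$G^p(u)=\overline{[u+\sigma\mathbf e_1-\tau\mathbf 1]^+}\ \mathbf 1_{\{u(1)=0\}}+\overline{[u+\sigma\mathbf e_{p+1}-\tau\mathbf 1]^+}\ \mathbf 1_{\{u(1)>0\}}.$$ *)

theory Defs
  imports "HOL-Probability.Probability"
begin

locale ergodic_automorphism = prob_space M for M :: "'a measure" +
  fixes \<theta> :: "'a \<Rightarrow> 'a"
  assumes bij: "bij_betw \<theta> (space M) (space M)"
    and measurable_theta: "\<theta> \<in> measurable M M"
    and measurable_theta_inv: "inv_into (space M) \<theta> \<in> measurable M M"
    and preserving: "distr M M \<theta> = M"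
    and ergodic: "\<And>A. A \<in> sets M \<Longrightarrow> \<theta> -` A \<inter> space M = A \<Longrightarrow>
                    measure M A = 0 \<or> measure M A = 1"

definition iter :: "'a measure \<Rightarrow> ('a \<Rightarrow> 'a) \<Rightarrow> int \<Rightarrow> 'a \<Rightarrow> 'a" where
  "iter M \<theta> n =
     (if 0 \<le> n then \<theta> ^^ nat n else inv_into (space M) \<theta> ^^ nat (- n))"

definition iid :: "'a measure \<Rightarrow> ('i \<Rightarrow> 'a \<Rightarrow> real) \<Rightarrow> bool" where
  "iid M X \<longleftrightarrow>
     prob_space.indep_vars M (\<lambda>_. borel) X UNIV \<and>
     (\<forall>m n. distr M borel (X m) = distr M borel (X n))"

(* Mutual independence of the two sequences is independence of the two
   sequence-valued random elements of the product space over int. *)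
definition GI_GI :: "'a measure \<Rightarrow> ('a \<Rightarrow> 'a) \<Rightarrow> ('a \<Rightarrow> real) \<Rightarrow> ('a \<Rightarrow> real) \<Rightarrow> bool" where
  "GI_GI M \<theta> \<sigma> \<tau> \<longleftrightarrow>
     iid M (\<lambda>n \<omega>. \<tau> (iter M \<theta> n \<omega>)) \<and>
     iid M (\<lambda>n \<omega>. \<sigma> (iter M \<theta> n \<omega>)) \<and>
     prob_space.indep_var M
       (\<Pi>\<^sub>M n\<in>(UNIV :: int set). borel) (\<lambda>\<omega> n. \<tau> (iter M \<theta> n \<omega>))
       (\<Pi>\<^sub>M n\<in>(UNIV :: int set). borel) (\<lambda>\<omega> n. \<sigma> (iter M \<theta> n \<omega>))"

definition measure_support :: "real measure \<Rightarrow> real set" where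
  "measure_support \<mu> = {x. \<forall>U. open U \<longrightarrow> x \<in> U \<longrightarrow> 0 < emeasure \<mu> U}"

(* Extended-real valued, since the supremum may be infinite. *)
definition Z :: "'a measure \<Rightarrow> ('a \<Rightarrow> 'a) \<Rightarrow> ('a \<Rightarrow> real) \<Rightarrow> ('a \<Rightarrow> real) \<Rightarrow> nat \<Rightarrow> 'a \<Rightarrow> ereal" where
  "Z M \<theta> \<sigma> \<tau> l \<omega> =
     max 0 (SUP k\<in>{l..}. ereal (\<sigma> (iter M \<theta> (- int k) \<omega>) -
                                  (\<Sum>i = 1..k. \<tau> (iter M \<theta> (- int i) \<omega>))))"

(* Vectors of R^S are lists of length S; coordinates are counted from 0,
   so u ! 0 is u(1) and u ! p is u(p+1). *)
definition ordered_orthant :: "nat \<Rightarrow> real list set" where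
  "ordered_orthant S = {u. length u = S \<and> (\<forall>x\<in>set u. 0 \<le> x) \<and> sorted u}"

definition random_vector :: "'a measure \<Rightarrow> nat \<Rightarrow> ('a \<Rightarrow> real list) \<Rightarrow> bool" where
  "random_vector M S W \<longleftrightarrow>
     (\<forall>\<omega>\<in>space M. length (W \<omega>) = S) \<and> (\<forall>i<S. (\<lambda>\<omega>. W \<omega> ! i) \<in> borel_measurable M)"

(* The ordered version of [u + s e - t 1]^+, where e is the basis vector of coordinate j. *)
definition serve :: "nat \<Rightarrow> real \<Rightarrow> real \<Rightarrow> real list \<Rightarrow> real list" where
  "serve j s t u =
     sort (map (\<lambda>i. max 0 (u ! i + (if i = j then s else 0) - t)) [0..<length u])"

definition G :: "nat \<Rightarrow> real \<Rightarrow> real \<Rightarrow> real list \<Rightarrow> real list" where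
  "G p s t u = (if u ! 0 = 0 then serve 0 s t u else serve p s t u)"

end

(* Start the queue empty m steps in the past and let u_m be the state reached at time 0.
   The p smallest workloads of u_m are dominated by Z_p <= ... <= Z_1, so the S - p largest
   queues are fed only when Z_p > 0, and by independence this input has mean
   E[sigma] P[Z_p > 0] < (S - p) E[tau]. A pathwise argument on the maximum and the total
   workload of these queues, together with the boundedness of the partial sums of a stationary
   sequence of negative mean, shows that (u_m)_m is almost surely bounded. As tau is unbounded
   and independent of the past, an interarrival time that empties the system whatever m has
   positive probability, and by ergodicity it almost surely happened in the past. Hence u_m is
   eventually constant in m, and its eventual value is the solution, although G is not
   monotone. *)

theory Submission
  imports Defs
begin

section \<open>Pathwise bounds\<close>

text \<open>\<open>G\<close> is not only non-monotone but also discontinuous where u(1) reaches 0,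
  so a mere limit of the states u_m could not be passed through \<open>G\<close>; exact eventual
  constancy can. The obstacle is the control of the q = S - p largest queues. Their total decreases
  at the full rate q per unit of time only while the smallest of them, queue p+1, does not run dry.
  When it does, the others may still be long, and the total is only known to be at most about q - 1
  times the maximum. Hence total and maximum are bounded together: the smallest of the q queues is
  at most their average, so a customer joining it produces a queue at most one service time above
  the bound for the average; conversely, when queue p+1 is short, one of the q shares of the bound
  on the total is spare and absorbs the errors. Service times are only integrable, so along a path
  they are bounded merely by D + \<open>\<epsilon>\<close> n at distance n in the past. This linear
  term is paid for with part of the strict gap in the traffic condition. The bounds hold for all n
  and do not involve m, which is why they are proved by induction on m.\<close>

lemma sorted_nth_le_iff:
  fixes xs :: "'a::linorder list"
  assumes "sorted xs" "i < length xs"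
  shows "xs ! i \<le> c \<longleftrightarrow> i < card {j. j < length xs \<and> xs ! j \<le> c}"
proof
  assume "xs ! i \<le> c"
  then have "{..i} \<subseteq> {j. j < length xs \<and> xs ! j \<le> c}"
    using assms by (auto intro: order_trans[OF sorted_nth_mono])
  then have "card {..i} \<le> card {j. j < length xs \<and> xs ! j \<le> c}"
    by (intro card_mono) auto
  then show "i < card {j. j < length xs \<and> xs ! j \<le> c}" by simp
next
  assume *: "i < card {j. j < length xs \<and> xs ! j \<le> c}"
  show "xs ! i \<le> c"
  proof (rule ccontr)
    assume "\<not> xs ! i \<le> c"
    then have "{j. j < length xs \<and> xs ! j \<le> c} \<subseteq> {..<i}"
      using sorted_nth_mono[OF assms(1), of i] by (auto simp: not_le) (meson leD leI order_trans)
    then have "card {j. j < length xs \<and> xs ! j \<le> c} \<le> card {..<i}"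
      by (intro card_mono) auto
    with * show False by simp
  qed
qed

text \<open>The number of entries below a level is invariant under permutation, so
  \<open>sort\<close> disappears: order statistics are bounded, and shown measurable, by
  counting.\<close>

lemma sort_nth_le_iff:
  fixes xs :: "'a::linorder list"
  assumes "i < length xs"
  shows "sort xs ! i \<le> c \<longleftrightarrow> i < card {j. j < length xs \<and> xs ! j \<le> c}"
proof -
  have "length (filter (\<lambda>x. x \<le> c) (sort xs)) = length (filter (\<lambda>x. x \<le> c) xs)"
    by (metis mset_filter mset_sort size_mset)
  with sorted_nth_le_iff[of "sort xs" i c] assms show ?thesis
    by (simp add: length_filter_conv_card)
qed

lemma sort_nth_leI:
  fixes xs :: "'a::linorder list"
  assumes "i < length xs" "I \<subseteq> {..<length xs}" "i < card I" "\<And>j. j \<in> I \<Longrightarrow> xs ! j \<le> c"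
  shows "sort xs ! i \<le> c"
proof -
  have "card I \<le> card {j. j < length xs \<and> xs ! j \<le> c}"
    using assms by (intro card_mono) auto
  with assms show ?thesis by (simp add: sort_nth_le_iff)
qed

lemma sum_sort_nth:
  fixes f :: "'a::linorder \<Rightarrow> 'b::comm_monoid_add"
  shows "(\<Sum>i<length xs. f (sort xs ! i)) = (\<Sum>i<length xs. f (xs ! i))"
proof -
  have "(\<Sum>i<length ys. f (ys ! i)) = sum_mset (image_mset f (mset ys))" for ys
    using sum_list_sum_nth[of "map f ys"]
    by (simp add: atLeast0LessThan sum_mset_sum_list flip: mset_map)
  from this[of "sort xs"] this[of xs] show ?thesis by simp
qed

text \<open>One half of the variational formula for the sum of the q largest entries, the minimum
  over \<open>c\<close> of q times \<open>c\<close> plus the total excess above \<open>c\<close>.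
  The right side ignores the order of \<open>xs\<close>, so choosing a good level replaces tracking
  the rearrangement.\<close>

lemma top_sum_sort_le:
  fixes xs :: "real list"
  assumes "p \<le> length xs"
  shows "(\<Sum>i=p..<length xs. sort xs ! i) \<le>
           (real (length xs) - real p) * c + (\<Sum>i<length xs. max 0 (xs ! i - c))"
proof -
  have "(\<Sum>i=p..<length xs. sort xs ! i)
          \<le> (\<Sum>i=p..<length xs. c + max 0 (sort xs ! i - c))"
    by (intro sum_mono) auto
  also have "\<dots> = (real (length xs) - real p) * c + (\<Sum>i=p..<length xs. max 0 (sort xs ! i - c))"
    using assms by (simp add: sum.distrib of_nat_diff)
  also have "(\<Sum>i=p..<length xs. max 0 (sort xs ! i - c)) \<le> (\<Sum>i<length xs. max 0 (sort xs ! i - c))"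
    by (intro sum_mono2) auto
  also have "\<dots> = (\<Sum>i<length xs. max 0 (xs ! i - c))"
    by (rule sum_sort_nth)
  finally show ?thesis by simp
qed

section \<open>Effect of one arrival on the ordered workloads\<close>

lemma length_serve [simp]: "length (serve j s t u) = length u"
  by (simp add: serve_def)

lemma length_G [simp]: "length (G p s t u) = length u"
  by (simp add: G_def)

lemma G_in_ordered_orthant:
  assumes "u \<in> ordered_orthant S"
  shows "G p s t u \<in> ordered_orthant S"
  using assms by (auto simp: ordered_orthant_def G_def serve_def)

lemma ordered_orthant_nth_nonneg: "u \<in> ordered_orthant S \<Longrightarrow> i < S \<Longrightarrow> 0 \<le> u ! i"
  by (auto simp: ordered_orthant_def)

lemma ordered_orthant_nth_mono: "u \<in> ordered_orthant S \<Longrightarrow> i \<le> j \<Longrightarrow> j < S \<Longrightarrow> u ! i \<le> u ! j"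
  by (auto simp: ordered_orthant_def sorted_nth_mono)

lemma serve_nth_leI:
  assumes "i < length u" "I \<subseteq> {..<length u}" "i < card I"
    and "\<And>k. k \<in> I \<Longrightarrow> max 0 (u ! k + (if k = j then s else 0) - t) \<le> c"
  shows "serve j s t u ! i \<le> c"
  unfolding serve_def using assms by (intro sort_nth_leI[where I = I]) auto

lemma serve_nth_le:
  assumes "i < length u" "I \<subseteq> {..<length u}" "i < card I"
    and "\<And>k. k \<in> I \<Longrightarrow> u ! k + (if k = j then s else 0) \<le> c"
  shows "serve j s t u ! i \<le> max 0 (c - t)"
  using assms by (intro serve_nth_leI[where I = I] max.mono diff_right_mono) auto

text \<open>Each bound exhibits \<open>i + 1\<close> queues below the level. With no free server the
  customer joins queue \<open>p\<close>, so queues 0 to \<open>i\<close> receive nothing. With a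
  free server queue 0 is joined, so queues 1 to \<open>i + 1\<close> receive nothing; the third
  bound, meant for \<open>i + 1 = p\<close>, keeps queues 0 to \<open>i\<close>, where queue 0 now
  carries \<open>s\<close>.\<close>

lemma G_nth_below:
  assumes u: "u \<in> ordered_orthant S" and "p < S" "i < p"
  shows "u ! 0 \<noteq> 0 \<Longrightarrow> G p s t u ! i \<le> max 0 (u ! i - t)"
    and "u ! 0 = 0 \<Longrightarrow> Suc i < p \<Longrightarrow> G p s t u ! i \<le> max 0 (u ! Suc i - t)"
    and "u ! 0 = 0 \<Longrightarrow> 0 \<le> s \<Longrightarrow> G p s t u ! i \<le> max 0 (max s (u ! i) - t)"
proof -
  note mono = ordered_orthant_nth_mono[OF u]
  have len: "length u = S" using u by (simp add: ordered_orthant_def)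
  show "G p s t u ! i \<le> max 0 (u ! i - t)" if "u ! 0 \<noteq> 0"
    using that assms(2,3) len mono[of _ i]
    by (auto simp: G_def intro!: serve_nth_le[where I = "{..i}"])
  show "G p s t u ! i \<le> max 0 (u ! Suc i - t)" if "u ! 0 = 0" "Suc i < p"
    using that assms(2,3) len mono[of _ "Suc i"]
    by (auto simp: G_def intro!: serve_nth_le[where I = "{1..Suc i}"])
  show "G p s t u ! i \<le> max 0 (max s (u ! i) - t)" if "u ! 0 = 0" "0 \<le> s"
    using that assms(2,3) len mono[of _ i]
    by (simp add: G_def, intro serve_nth_le[where I = "{..i}"]) (auto simp: le_max_iff_disj)
qed

lemma G_nth_le:
  assumes u: "u \<in> ordered_orthant S" and "p < S" "i < S" "0 \<le> s"
  shows "G p s t u ! i \<le> max 0 (max (u ! (S - 1)) (u ! p + s) - t)"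
proof -
  have "u ! k \<le> u ! (S - 1)" if "k < S" for k
    using that by (intro ordered_orthant_nth_mono[OF u]) auto
  moreover have "0 \<le> u ! p" using assms by (simp add: ordered_orthant_nth_nonneg)
  moreover have "length u = S" using u by (simp add: ordered_orthant_def)
  ultimately show ?thesis
    using assms(2-4)
    by (simp add: G_def, intro conjI impI serve_nth_le[where I = "{..<S}"])
       (auto simp: le_max_iff_disj)
qed

lemma serve_top_sum_le:
  assumes "length u = S" "p < S"
  shows "(\<Sum>i=p..<S. serve j s t u ! i) \<le>
           (real S - real p) * c +
           (\<Sum>i<S. max 0 (max 0 (u ! i + (if i = j then s else 0) - t) - c))"
  using top_sum_sort_le[of p "map (\<lambda>i. max 0 (u ! i + (if i = j then s else 0) - t)) [0..<length u]" c] assms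
  by (simp add: serve_def)

lemma G_top_sum_le:
  assumes u: "u \<in> ordered_orthant S" and "p < S" and nn: "0 \<le> s" "0 \<le> t"
  shows "(\<Sum>i=p..<S. G p s t u ! i) \<le>
           (real S - real p) * (s + u ! p) + (real S - real p - 1) * u ! (S - 1)"
proof -
  have len: "length u = S" using u by (simp add: ordered_orthant_def)
  \<comment> \<open>At this level no queue of index at most \<open>p\<close> has an excess, even the
    one that receives \<open>s\<close>; each of the other q - 1 queues has an excess of at most the
    maximum.\<close>
  define c where "c = s + u ! p"
  have up: "0 \<le> u ! p" using assms by (simp add: ordered_orthant_nth_nonneg)
  have "(\<Sum>i=p..<S. serve j s t u ! i) \<le> (real S - real p) * c + (real S - real p - 1) * u ! (S - 1)"
    if "j \<le> p" for j
  proof -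
    have "max 0 (max 0 (u ! i + (if i = j then s else 0) - t) - c) \<le> (if p < i then u ! (S - 1) else 0)"
      if "i < S" for i
    proof -
      have "u ! i \<le> u ! (S - 1)" "0 \<le> u ! i"
        using that by (auto intro!: ordered_orthant_nth_mono[OF u] ordered_orthant_nth_nonneg[OF u])
      then show ?thesis
        using that \<open>j \<le> p\<close> nn up ordered_orthant_nth_mono[OF u, of i p] \<open>p < S\<close>
        by (auto simp: c_def)
    qed
    then have "(\<Sum>i<S. max 0 (max 0 (u ! i + (if i = j then s else 0) - t) - c))
        \<le> (\<Sum>i<S. if p < i then u ! (S - 1) else 0)"
      by (intro sum_mono) auto
    also have "\<dots> = (\<Sum>i\<in>{p<..<S}. u ! (S - 1))"
      by (intro sum.mono_neutral_cong_right) auto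
    also have "\<dots> = (real S - real p - 1) * u ! (S - 1)"
      using \<open>p < S\<close> by (simp add: of_nat_diff)
    finally show ?thesis
      using serve_top_sum_le[OF len \<open>p < S\<close>, of j s t c] by simp
  qed
  then show ?thesis by (simp add: G_def c_def)
qed

lemma G_top_sum_le_of_busy:
  assumes u: "u \<in> ordered_orthant S" and "p < S" and "0 < p" and nn: "0 \<le> s" "0 \<le> t"
    and busy: "s \<le> u ! p" "t \<le> u ! p"
  shows "(\<Sum>i=p..<S. G p s t u ! i) \<le>
           (\<Sum>i=p..<S. u ! i) + (if u ! 0 = 0 then 0 else s) - (real S - real p) * t"
proof -
  have len: "length u = S" using u by (simp add: ordered_orthant_def)
  \<comment> \<open>The level that queue \<open>p\<close> reaches if it receives nothing. As
    \<open>t \<le> u ! p\<close>, none of the largest queues runs dry; as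
    \<open>s \<le> u ! p\<close>, a customer served at the free queue 0 stays below the level and
    does not count.\<close>
  define c where "c = u ! p - t"
  define j where "j = (if u ! 0 = 0 then 0 else p)"
  have "max 0 (max 0 (u ! i + (if i = j then s else 0) - t) - c)
      = (if p \<le> i then u ! i - u ! p + (if i = j then s else 0) else 0)"
    if "i < S" for i
    using that nn busy ordered_orthant_nth_mono[OF u, of i p] \<open>p < S\<close> \<open>0 < p\<close>
      ordered_orthant_nth_mono[OF u, of p i] ordered_orthant_nth_nonneg[OF u, of i]
    by (auto simp: c_def j_def max_def)
  then have "(\<Sum>i<S. max 0 (max 0 (u ! i + (if i = j then s else 0) - t) - c))
      = (\<Sum>i<S. if p \<le> i then u ! i - u ! p + (if i = j then s else 0) else 0)"
    by (intro sum.cong) auto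
  also have "\<dots> = (\<Sum>i=p..<S. u ! i - u ! p + (if i = j then s else 0))"
    by (intro sum.mono_neutral_cong_right) auto
  also have "\<dots> = (\<Sum>i=p..<S. u ! i) - (real S - real p) * u ! p + (if u ! 0 = 0 then 0 else s)"
    using \<open>p < S\<close> \<open>0 < p\<close> by (simp add: sum.distrib sum_subtractf of_nat_diff j_def)
  finally have "(\<Sum>i=p..<S. serve j s t u ! i) \<le>
      (real S - real p) * c + ((\<Sum>i=p..<S. u ! i) - (real S - real p) * u ! p + (if u ! 0 = 0 then 0 else s))"
    using serve_top_sum_le[OF len \<open>p < S\<close>, of j s t c] by simp
  moreover have "G p s t u = serve j s t u" by (simp add: G_def j_def)
  ultimately show ?thesis by (simp add: c_def algebra_simps)
qed

lemma G_eq_replicate_0: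
  assumes "u \<in> ordered_orthant S" "p < S" "0 \<le> s" "u ! (S - 1) + s \<le> t"
  shows "G p s t u = replicate S 0"
proof (rule nth_equalityI)
  have mem: "G p s t u \<in> ordered_orthant S" using assms(1) by (rule G_in_ordered_orthant)
  then show "length (G p s t u) = length (replicate S (0::real))"
    by (simp add: ordered_orthant_def)
  fix i assume "i < length (G p s t u)"
  with mem have i: "i < S" by (simp add: ordered_orthant_def)
  have "u ! p \<le> u ! (S - 1)"
    using assms by (intro ordered_orthant_nth_mono[OF assms(1)]) auto
  with G_nth_le[OF assms(1,2) i assms(3), of t] assms have "G p s t u ! i \<le> 0" by auto
  with ordered_orthant_nth_nonneg[OF mem i] i show "G p s t u ! i = replicate S 0 ! i" by auto
qed

text \<open>Sequences are indexed backwards in time: \<open>s n\<close> belongs to the customer \<open>- n\<close>, and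
  \<open>loynes p S s t m n\<close> is the workload found by that customer when the system was
  empty \<open>m\<close> arrivals earlier.\<close>

fun loynes :: "nat \<Rightarrow> nat \<Rightarrow> (nat \<Rightarrow> real) \<Rightarrow> (nat \<Rightarrow> real) \<Rightarrow> nat \<Rightarrow> nat \<Rightarrow> real list" where
  "loynes p S s t 0 n = replicate S 0"
| "loynes p S s t (Suc m) n = G p (s (Suc n)) (t (Suc n)) (loynes p S s t m (Suc n))"

lemma loynes_in_ordered_orthant: "loynes p S s t m n \<in> ordered_orthant S"
  by (induction m arbitrary: n) (auto simp: G_in_ordered_orthant, simp add: ordered_orthant_def)

lemma length_loynes [simp]: "length (loynes p S s t m n) = S"
  using loynes_in_ordered_orthant[of p S s t m n] by (simp add: ordered_orthant_def)

lemma loynes_shift: "loynes p S s t m (n + k) = loynes p S (\<lambda>i. s (i + k)) (\<lambda>i. t (i + k)) m n"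
  by (induction m arbitrary: n) (auto simp flip: add_Suc)

lemma loynes_cong:
  assumes "\<And>k. n < k \<Longrightarrow> s k = s' k" "\<And>k. n < k \<Longrightarrow> t k = t' k"
  shows "loynes p S s t m n = loynes p S s' t' m n"
  using assms by (induction m arbitrary: n) auto

text \<open>All runs started before index \<open>n\<close> pass through the empty state there, and
  from then on they follow the run started empty at \<open>n\<close>.\<close>

lemma loynes_eq_of_reset:
  assumes "\<And>m. loynes p S s t (Suc m) n = replicate S 0"
  shows "n = j + i \<Longrightarrow> loynes p S s t (Suc (m + i)) j = loynes p S s t i j"
  by (induction i arbitrary: j) (use assms in auto)

text \<open>In the paper's notation: \<open>u(i) \<le> Z\<^sub>p\<^sub>+\<^sub>1\<^sub>-\<^sub>i\<close> for \<open>i = 1, \<dots>, p\<close>.\<close>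

lemma loynes_nth_le:
  assumes "p < S" "\<And>n. 0 \<le> s n" "\<And>n. 0 \<le> t n" "i < p"
  shows "loynes p S s t m n ! i \<le> 0 \<or>
    (\<exists>k\<ge>p - i. loynes p S s t m n ! i \<le> s (n + k) - (\<Sum>j=1..k. t (n + j)))"
  using \<open>i < p\<close>
proof (induction m arbitrary: n i)
  case 0
  then show ?case using assms by simp
next
  case (Suc m)
  define u where "u = loynes p S s t m (Suc n)"
  define v where "v = loynes p S s t (Suc m) n"
  have u: "u \<in> ordered_orthant S" by (simp add: u_def loynes_in_ordered_orthant)
  have v: "v = G p (s (Suc n)) (t (Suc n)) u" by (simp add: v_def u_def)
  note below = G_nth_below[OF u \<open>p < S\<close> \<open>i < p\<close>, of "s (Suc n)" "t (Suc n)", folded v]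
  \<comment> \<open>A bound for rank \<open>i'\<close> one customer earlier is inherited:
    \<open>k\<close> becomes \<open>Suc k\<close> and \<open>t (Suc n)\<close> joins the sum. This
    gain of one in \<open>k\<close> allows a rank \<open>i'\<close> larger than \<open>i\<close> by
    one, as occurs when queue 0 is joined.\<close>
  have shift: "v ! i \<le> 0 \<or> (\<exists>k\<ge>p - i. v ! i \<le> s (n + k) - (\<Sum>j=1..k. t (n + j)))"
    if "v ! i \<le> max 0 (u ! i' - t (Suc n))" "i' < p" "p - i \<le> Suc (p - i')" for i'
  proof -
    from Suc.IH[OF \<open>i' < p\<close>, of "Suc n"] consider "u ! i' \<le> 0" |
      k where "k \<ge> p - i'" "u ! i' \<le> s (Suc n + k) - (\<Sum>j=1..k. t (Suc n + j))"
      unfolding u_def by blast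
    then show ?thesis
    proof cases
      case 1
      with that(1) assms(3)[of "Suc n"] show ?thesis by auto
    next
      case 2
      have "(\<Sum>j=1..Suc k. t (n + j)) = t (Suc n) + (\<Sum>j=1..k. t (Suc n + j))"
        by (subst sum.atLeast_Suc_atMost)
           (auto simp: sum.atLeast_Suc_atMost_Suc_shift simp del: sum.cl_ivl_Suc)
      with 2 that show ?thesis
        by (auto simp: max_def intro!: exI[of _ "Suc k"] split: if_splits)
    qed
  qed
  have "v ! i \<le> 0 \<or> (\<exists>k\<ge>p - i. v ! i \<le> s (n + k) - (\<Sum>j=1..k. t (n + j)))"
  proof (cases "u ! 0 = 0")
    case False
    show ?thesis by (rule shift[OF below(1)[OF False] \<open>i < p\<close>]) simp
  next
    case True
    show ?thesis
    proof (cases "Suc i < p")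
      case less: True
      show ?thesis by (rule shift[OF below(2)[OF True less] less]) simp
    next
      case False
      \<comment> \<open>For the top rank below \<open>p\<close> there is no rank
        \<open>i + 1\<close> to inherit from, so the customer just served may itself set the bound;
        it is the witness \<open>k = 1\<close>.\<close>
      then have "p - i = 1" using \<open>i < p\<close> by simp
      have "v ! i \<le> max 0 (s (Suc n) - t (Suc n)) \<or> v ! i \<le> max 0 (u ! i - t (Suc n))"
        using below(3)[OF True] assms(2)[of "Suc n"] by (auto simp: max_def split: if_splits)
      then show ?thesis
      proof
        assume "v ! i \<le> max 0 (s (Suc n) - t (Suc n))"
        with \<open>p - i = 1\<close> show ?thesis
          by (auto simp: le_max_iff_disj intro!: exI[of _ 1])
      next
        assume "v ! i \<le> max 0 (u ! i - t (Suc n))"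
        then show ?thesis by (rule shift[OF _ \<open>i < p\<close>]) simp
      qed
    qed
  qed
  then show ?case by (simp add: v_def del: loynes.simps)
qed

text \<open>The extra slope \<open>\<epsilon>\<close> lets the bound \<open>D + \<epsilon> n\<close> on the service times drift with \<open>n\<close>.
  The two bounds are proved together: while the queue \<open>p + 1\<close> exceeds \<open>s\<close> and \<open>t\<close>, the
  total workload of the \<open>q\<close> largest queues has increments at most \<open>q c\<close>; otherwise it is
  at most \<open>q - 1\<close> times the maximum, up to terms absorbed by \<open>X\<close>.\<close>

lemma loynes_bound:
  fixes p S :: nat and s t a c :: "nat \<Rightarrow> real" and q D X \<epsilon> :: real
  defines "q \<equiv> real S - real p"
  defines "a \<equiv> \<lambda>n. if \<exists>k\<ge>p. 0 < s (n + k) - (\<Sum>j=1..k. t (n + j)) then s n else 0"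
  defines "c \<equiv> \<lambda>n. a n / q - t n + \<epsilon>"
  assumes p: "0 < p" "p < S" and nn: "\<And>n. 0 \<le> s n" "\<And>n. 0 \<le> t n" "0 \<le> \<epsilon>" "0 \<le> D" "0 \<le> X"
    and D: "\<And>n. 0 < n \<Longrightarrow> s n \<le> D + \<epsilon> * real n"
    and X: "\<And>n. 0 < n \<Longrightarrow>
      2 * q * (s n + t n) + (q - 1) * (D + \<epsilon> * real n) + (\<Sum>i=1..n. c i) \<le> X"
  shows "loynes p S s t m n ! (S - 1) \<le> X - (\<Sum>i=1..n. c i) + D + \<epsilon> * real n \<and>
    (\<Sum>i=p..<S. loynes p S s t m n ! i) \<le> q * (X - (\<Sum>i=1..n. c i))"
proof (induction m arbitrary: n)
  have q: "1 \<le> q" using p by (simp add: q_def)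
  define C where "C n = (\<Sum>i=1..n. c i)" for n
  have CX: "C n \<le> X" for n
  proof (cases "n = 0")
    case False
    have "0 \<le> 2 * q * (s n + t n) + (q - 1) * (D + \<epsilon> * real n)"
      using q nn by simp
    with X[of n] False show ?thesis unfolding C_def by linarith
  qed (simp add: C_def nn)
  {
    case 0
    have "0 \<le> q * (X - C n)" using CX[of n] q by simp
    moreover have "0 \<le> X - C n + D + \<epsilon> * real n" using CX[of n] nn by simp
    ultimately show ?case using p by (simp add: C_def)
  next
    case (Suc m)
    define N where "N = Suc n"
    define u where "u = loynes p S s t m N"
    define v where "v = loynes p S s t (Suc m) n"
    have v: "v = G p (s N) (t N) u" by (simp add: v_def u_def N_def)
    have u: "u \<in> ordered_orthant S" and v_mem: "v \<in> ordered_orthant S"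
      by (simp_all add: u_def v_def loynes_in_ordered_orthant del: loynes.simps)
    have IH: "u ! (S - 1) \<le> X - C N + D + \<epsilon> * real N" "(\<Sum>i=p..<S. u ! i) \<le> q * (X - C N)"
      using Suc[of N] by (simp_all add: u_def C_def)
    have CN: "C N = C n + c N" by (simp add: C_def N_def)
    have a_nn: "0 \<le> a N" using nn by (simp add: a_def)
    have cN: "- t N + \<epsilon> \<le> c N" using a_nn q by (simp add: c_def)
    \<comment> \<open>The smallest of the q queues is at most their average: this is how the bound
      on the total feeds the bound on the maximum.\<close>
    have "q * (u ! p) = (\<Sum>i=p..<S. u ! p)" using p by (simp add: q_def of_nat_diff)
    also have "\<dots> \<le> (\<Sum>i=p..<S. u ! i)"
      by (intro sum_mono ordered_orthant_nth_mono[OF u]) auto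
    also note IH(2)
    finally have up: "u ! p \<le> X - C N" using q by simp
    have "v ! (S - 1) \<le> max 0 (max (u ! (S - 1)) (u ! p + s N) - t N)"
      unfolding v using p nn by (intro G_nth_le[OF u]) auto
    also have "\<dots> \<le> X - C n + D + \<epsilon> * real n"
    proof -
      have "s N \<le> D + \<epsilon> * real N" using D[of N] by (simp add: N_def)
      moreover have "\<epsilon> * real N = \<epsilon> * real n + \<epsilon>" by (simp add: N_def algebra_simps)
      moreover have "0 \<le> X - C n + D + \<epsilon> * real n" using CX[of n] nn by simp
      ultimately show ?thesis using IH(1) up cN CN by auto
    qed
    finally have 1: "v ! (S - 1) \<le> X - C n + D + \<epsilon> * real n" .
    have 2: "(\<Sum>i=p..<S. v ! i) \<le> q * (X - C n)"
    proof (cases "s N \<le> u ! p \<and> t N \<le> u ! p")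
      case True
      \<comment> \<open>A positive \<open>u ! 0\<close> forces a positive term with
        \<open>k \<ge> p\<close>, by the bound for rank 0, so the customer is counted in
        \<open>a N\<close>.\<close>
      have busy: "(if u ! 0 = 0 then 0 else s N) \<le> a N"
      proof (cases "u ! 0 = 0")
        case False
        with ordered_orthant_nth_nonneg[OF u, of 0] p have "0 < u ! 0" by auto
        with loynes_nth_le[of p S s t 0 m N] p nn have "\<exists>k\<ge>p. 0 < s (N + k) - (\<Sum>j=1..k. t (N + j))"
          by (fastforce simp: u_def)
        with False show ?thesis by (simp add: a_def)
      qed (simp add: a_nn)
      have "(\<Sum>i=p..<S. v ! i) \<le> (\<Sum>i=p..<S. u ! i) + (if u ! 0 = 0 then 0 else s N) - q * t N"
        unfolding v q_def using True p nn by (intro G_top_sum_le_of_busy[OF u]) auto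
      also have "\<dots> \<le> q * (X - C N) + a N - q * t N"
        using IH(2) busy by linarith
      also have "\<dots> \<le> q * (X - C N) + q * c N"
        using q nn by (simp add: c_def field_simps)
      finally show ?thesis by (simp add: CN algebra_simps)
    next
      case False
      then have "u ! p \<le> s N + t N" using nn(1,2)[of N] by auto
      have "(\<Sum>i=p..<S. v ! i) \<le> q * (s N + u ! p) + (q - 1) * u ! (S - 1)"
        unfolding v q_def using p nn by (intro G_top_sum_le[OF u]) auto
      also have "\<dots> \<le> q * (2 * s N + t N) + (q - 1) * (X - C N + D + \<epsilon> * real N)"
        using IH(1) q \<open>u ! p \<le> s N + t N\<close>
        by (intro add_mono[of "q * (s N + u ! p)"] mult_left_mono) simp_all
      \<comment> \<open>Only q - 1 copies of \<open>X - C N\<close> are used so far; the spare one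
        absorbs the rest. The factor \<open>2 * q\<close> in the hypothesis collects
        \<open>q * (2 * s N + t N)\<close> and the \<open>q * t N\<close> subtracted here.\<close>
      also have "\<dots> \<le> q * (X - C N) - q * t N"
        using X[of N, folded C_def] by (simp add: N_def algebra_simps)
      also have "\<dots> \<le> q * (X - C n)"
      proof -
        have "q * (- t N) \<le> q * c N" using cN nn q by (intro mult_left_mono) auto
        then show ?thesis by (simp add: CN algebra_simps)
      qed
      finally show ?thesis .
    qed
    from 1 2 show ?case by (simp add: C_def v_def del: loynes.simps)
  }
qed

section \<open>Measurability and ergodicity\<close>

text \<open>The count in \<open>sort_nth_le_iff\<close> is a finite sum of indicators of measurable
  events. Measurability of random lists is treated coordinate by coordinate throughout.\<close>

lemma borel_measurable_sort_nth:
  fixes f :: "'a \<Rightarrow> real list"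
  assumes len: "\<And>x. length (f x) = n" and meas: "\<And>j. j < n \<Longrightarrow> (\<lambda>x. f x ! j) \<in> borel_measurable N"
    and "i < n"
  shows "(\<lambda>x. sort (f x) ! i) \<in> borel_measurable N"
proof (subst borel_measurable_iff_le, intro allI)
  fix c
  have 1: "real (card {j. j < n \<and> f x ! j \<le> c}) = (\<Sum>j<n. if f x ! j \<le> c then 1 else 0)" for x
    using sum.inter_filter[of "{..<n}" "\<lambda>_. 1::real" "\<lambda>j. f x ! j \<le> c"] by simp
  have 2: "sort (f x) ! i \<le> c \<longleftrightarrow> real i < real (card {j. j < n \<and> f x ! j \<le> c})" for x
    using \<open>i < n\<close> by (simp add: sort_nth_le_iff len)
  have "{x \<in> space N. sort (f x) ! i \<le> c} =
      {x \<in> space N. real i < (\<Sum>j<n. if f x ! j \<le> c then 1 else 0)}"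
    by (simp only: 1 2)
  also have "\<dots> \<in> sets N"
    by measurable (use meas in simp)
  finally show "{x \<in> space N. sort (f x) ! i \<le> c} \<in> sets N" .
qed

lemma borel_measurable_serve_nth:
  fixes f :: "'a \<Rightarrow> real list"
  assumes len: "\<And>x. length (f x) = S" and f: "\<And>i. i < S \<Longrightarrow> (\<lambda>x. f x ! i) \<in> borel_measurable N"
    and [measurable]: "s \<in> borel_measurable N" "t \<in> borel_measurable N" and "i < S"
  shows "(\<lambda>x. serve j (s x) (t x) (f x) ! i) \<in> borel_measurable N"
  unfolding serve_def
proof (rule borel_measurable_sort_nth[OF _ _ \<open>i < S\<close>])
  fix k assume "k < S"
  note f[OF this, measurable]
  show "(\<lambda>x. map (\<lambda>i. max 0 (f x ! i + (if i = j then s x else 0) - t x)) [0..<length (f x)] ! k)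
      \<in> borel_measurable N"
    using \<open>k < S\<close> by (simp add: len)
qed (simp add: len)

text \<open>The space \<open>N\<close> is arbitrary because the lemma serves both on
  \<open>M\<close> and on the product space of past inputs, where independence is applied.\<close>

lemma borel_measurable_loynes_nth:
  assumes s: "\<And>n. 0 < n \<Longrightarrow> s n \<in> borel_measurable N" and t: "\<And>n. 0 < n \<Longrightarrow> t n \<in> borel_measurable N"
    and "i < S"
  shows "(\<lambda>x. loynes p S (\<lambda>n. s n x) (\<lambda>n. t n x) m n ! i) \<in> borel_measurable N"
  using \<open>i < S\<close>
proof (induction m arbitrary: n i)
  case (Suc m)
  let ?u = "\<lambda>x. loynes p S (\<lambda>n. s n x) (\<lambda>n. t n x) m (Suc n)"
  have u: "(\<lambda>x. ?u x ! j) \<in> borel_measurable N" if "j < S" for j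
    using Suc.IH[OF that] .
  have [measurable]: "(\<lambda>x. ?u x ! 0) \<in> borel_measurable N"
    using u[of 0] Suc.prems by simp
  have [measurable]: "(\<lambda>x. serve j (s (Suc n) x) (t (Suc n) x) (?u x) ! i) \<in> borel_measurable N" for j
    using Suc.prems by (intro borel_measurable_serve_nth[where S = S] u s t) auto
  show ?case by (simp add: G_def if_distrib[of "\<lambda>v. v ! i"])
qed simp

section \<open>Backward orbits: recurrence and sums with negative mean\<close>

context ergodic_automorphism
begin

abbreviation (input) T :: "'a \<Rightarrow> 'a" where "T \<equiv> inv_into (space M) \<theta>"

lemma iter_minus: "iter M \<theta> (- int n) = T ^^ n"
  by (cases "n = 0") (auto simp: iter_def)

lemma theta_in_space: "\<omega> \<in> space M \<Longrightarrow> \<theta> \<omega> \<in> space M"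
  using measurable_space[OF measurable_theta] .

lemma T_theta: "\<omega> \<in> space M \<Longrightarrow> T (\<theta> \<omega>) = \<omega>"
  using bij by (simp add: bij_betw_def)

lemma funpow_T_theta: "\<omega> \<in> space M \<Longrightarrow> (T ^^ Suc n) (\<theta> \<omega>) = (T ^^ n) \<omega>"
  by (simp add: funpow_Suc_right T_theta del: funpow.simps)

lemma measurable_funpow_T [measurable]: "(T ^^ n) \<in> measurable M M"
proof (induction n)
  case (Suc n)
  from measurable_comp[OF this measurable_theta_inv] show ?case by (simp add: comp_def)
qed simp

lemma funpow_T_in_space: "\<omega> \<in> space M \<Longrightarrow> (T ^^ n) \<omega> \<in> space M"
  using measurable_space[OF measurable_funpow_T] .

lemma distr_T: "distr M M T = M"
proof -
  have "distr M M T = distr (distr M M \<theta>) M T" by (simp add: preserving)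
  also have "\<dots> = distr M M (T \<circ> \<theta>)"
    by (rule distr_distr[OF measurable_theta_inv measurable_theta])
  also have "\<dots> = distr M M (\<lambda>x. x)"
    by (intro distr_cong) (auto simp: T_theta)
  finally show ?thesis by simp
qed

lemma distr_funpow_T: "distr M M (T ^^ n) = M"
proof (induction n)
  case (Suc n)
  have "distr M M (T ^^ Suc n) = distr (distr M M (T ^^ n)) M T"
    by (subst distr_distr) (auto intro: measurable_theta_inv)
  with Suc distr_T show ?case by (simp add: comp_def)
qed (simp add: id_def)

text \<open>The event of infinitely many visits is strictly invariant, hence of probability 0 or 1.
  It is the decreasing limit of the events \<open>B N\<close>, each of probability at least
  \<open>prob A\<close> by stationarity.\<close>

lemma AE_recurrence:
  assumes A [measurable]: "A \<in> sets M" and "0 < prob A"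
  shows "AE \<omega> in M. \<exists>k\<ge>1. (T ^^ k) \<omega> \<in> A"
proof -
  define B where "B N = {\<omega> \<in> space M. \<exists>k\<ge>N. (T ^^ k) \<omega> \<in> A}" for N
  have B [measurable]: "B N \<in> sets M" for N unfolding B_def by measurable
  have "(\<Inter>N. B N) \<in> sets M" by (rule sets.countable_INT) auto
  moreover have "\<theta> -` (\<Inter>N. B N) \<inter> space M = (\<Inter>N. B N)"
  proof (intro equalityI subsetI)
    fix \<omega> assume \<omega>: "\<omega> \<in> \<theta> -` (\<Inter>N. B N) \<inter> space M"
    show "\<omega> \<in> (\<Inter>N. B N)"
    proof
      fix N
      from \<omega> obtain k where "k \<ge> Suc N" "(T ^^ k) (\<theta> \<omega>) \<in> A" by (auto simp: B_def)
      with \<omega> funpow_T_theta[of \<omega> "k - 1"] show "\<omega> \<in> B N"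
        by (auto simp: B_def intro!: exI[of _ "k - 1"])
    qed
  next
    fix \<omega> assume \<omega>: "\<omega> \<in> (\<Inter>N. B N)"
    then have sp: "\<omega> \<in> space M" by (auto simp: B_def)
    have "\<theta> \<omega> \<in> B N" for N
    proof -
      from \<omega> obtain k where "k \<ge> N" "(T ^^ k) \<omega> \<in> A" by (auto simp: B_def)
      with funpow_T_theta[OF sp, of k] theta_in_space[OF sp] show ?thesis
        by (auto simp: B_def intro!: exI[of _ "Suc k"])
    qed
    with sp show "\<omega> \<in> \<theta> -` (\<Inter>N. B N) \<inter> space M" by auto
  qed
  ultimately have "prob (\<Inter>N. B N) = 0 \<or> prob (\<Inter>N. B N) = 1" by (rule ergodic)
  moreover have "prob A \<le> prob (\<Inter>N. B N)"
  proof (rule LIMSEQ_le_const)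
    show "(\<lambda>N. prob (B N)) \<longlonglongrightarrow> prob (\<Inter>N. B N)"
      by (rule finite_Lim_measure_decseq) (auto simp: decseq_def B_def, meson order_trans)
    have "prob A \<le> prob (B N)" for N
    proof -
      have "prob A = measure (distr M M (T ^^ N)) A" by (simp add: distr_funpow_T)
      also have "\<dots> = prob ((T ^^ N) -` A \<inter> space M)" by (rule measure_distr) auto
      also have "\<dots> \<le> prob (B N)" by (rule finite_measure_mono) (auto simp: B_def)
      finally show ?thesis .
    qed
    then show "\<exists>N. \<forall>n\<ge>N. prob A \<le> prob (B n)" by auto
  qed
  ultimately have "prob (\<Inter>N. B N) = 1" using \<open>0 < prob A\<close> by auto
  then have "AE \<omega> in M. \<omega> \<in> (\<Inter>N. B N)"
    using prob_eq_1[of "\<Inter>N. B N"] \<open>(\<Inter>N. B N) \<in> sets M\<close> by simp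
  then show ?thesis by (rule AE_mp) (auto simp: B_def)
qed

text \<open>The maximum of 0 and the first \<open>n\<close> partial sums of \<open>\<xi>\<close>
  along the backward orbit, in recursive form; equivalently, a single-server workload started empty
  \<open>n\<close> steps earlier.\<close>

primrec lindley :: "('a \<Rightarrow> real) \<Rightarrow> nat \<Rightarrow> 'a \<Rightarrow> real" where
  "lindley \<xi> 0 \<omega> = 0"
| "lindley \<xi> (Suc n) \<omega> = max 0 (\<xi> (T \<omega>) + lindley \<xi> n (T \<omega>))"

lemma lindley_nonneg: "0 \<le> lindley \<xi> n \<omega>"
  by (cases n) auto

lemma lindley_le_Suc: "lindley \<xi> n \<omega> \<le> lindley \<xi> (Suc n) \<omega>"
proof (induction n arbitrary: \<omega>)
  case (Suc n)
  show ?case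
    unfolding lindley.simps(2)[of \<xi> n \<omega>] lindley.simps(2)[of \<xi> "Suc n" \<omega>]
    by (intro max.mono add_left_mono Suc order_refl)
qed simp

lemma lindley_mono: "m \<le> n \<Longrightarrow> lindley \<xi> m \<omega> \<le> lindley \<xi> n \<omega>"
  by (rule lift_Suc_mono_le[of "\<lambda>n. lindley \<xi> n \<omega>"]) (rule lindley_le_Suc)

lemma sum_Suc_shift: "(\<Sum>i=1..Suc n. \<xi> ((T ^^ i) \<omega>)) = \<xi> (T \<omega>) + (\<Sum>i=1..n. \<xi> ((T ^^ i) (T \<omega>)))"
proof -
  have "(\<Sum>i=1..Suc n. \<xi> ((T ^^ i) \<omega>)) = \<xi> (T \<omega>) + (\<Sum>i=Suc 1..Suc n. \<xi> ((T ^^ i) \<omega>))"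
    by (subst sum.atLeast_Suc_atMost) auto
  also have "(\<Sum>i=Suc 1..Suc n. \<xi> ((T ^^ i) \<omega>)) = (\<Sum>i=1..n. \<xi> ((T ^^ Suc i) \<omega>))"
    by (rule sum.shift_bounds_cl_Suc_ivl)
  finally show ?thesis by (simp add: funpow_swap1)
qed

lemma sum_le_lindley: "(\<Sum>i=1..n. \<xi> ((T ^^ i) \<omega>)) \<le> lindley \<xi> n \<omega>"
proof (induction n arbitrary: \<omega>)
  case (Suc n)
  from Suc[of "T \<omega>"] show ?case unfolding sum_Suc_shift by simp
qed simp

lemma integral_comp_T:
  fixes f :: "'a \<Rightarrow> real"
  assumes "integrable M f"
  shows "integrable M (\<lambda>\<omega>. f (T \<omega>))" "(\<integral>\<omega>. f (T \<omega>) \<partial>M) = (\<integral>\<omega>. f \<omega> \<partial>M)"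
  using assms integrable_distr[OF measurable_theta_inv, of f] integral_distr[OF measurable_theta_inv, of f]
  by (auto simp: distr_T)

lemma integrable_lindley: "integrable M \<xi> \<Longrightarrow> integrable M (lindley \<xi> n)"
proof (induction n)
  case (Suc n)
  then have "integrable M (\<lambda>\<omega>. max 0 (\<xi> \<omega> + lindley \<xi> n \<omega>))" by auto
  from integral_comp_T(1)[OF this] show ?case by simp
next
  case 0
  have "lindley \<xi> 0 = (\<lambda>_. 0)" by (simp add: fun_eq_iff)
  then show ?case by simp
qed

text \<open>The event that the sums are unbounded is invariant. If it had probability 1,
  \<open>lindley\<close> would increase to infinity almost surely; the increments of its mean, all
  nonnegative, would then converge to the negative mean of \<open>\<xi>\<close>.\<close>

lemma AE_partial_sums_bounded:
  fixes \<xi> :: "'a \<Rightarrow> real"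
  assumes \<xi> [simp]: "integrable M \<xi>" and neg: "(\<integral>\<omega>. \<xi> \<omega> \<partial>M) < 0"
  shows "AE \<omega> in M. \<exists>b. \<forall>n. (\<Sum>i=1..n. \<xi> ((T ^^ i) \<omega>)) \<le> b"
proof -
  have [measurable]: "\<xi> \<in> borel_measurable M" using \<xi> by (rule borel_measurable_integrable)
  define E where "E = {\<omega> \<in> space M. \<forall>b::nat. \<exists>n. real b < (\<Sum>i=1..n. \<xi> ((T ^^ i) \<omega>))}"
  have E [measurable]: "E \<in> sets M" unfolding E_def by measurable
  have step: "(\<Sum>i=1..Suc n. \<xi> ((T ^^ i) (\<theta> \<omega>))) = \<xi> \<omega> + (\<Sum>i=1..n. \<xi> ((T ^^ i) \<omega>))"
    if "\<omega> \<in> space M" for \<omega> n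
    using that by (subst sum_Suc_shift) (simp add: T_theta)
  have "\<theta> -` E \<inter> space M = E"
  proof (intro equalityI subsetI)
    fix \<omega> assume "\<omega> \<in> \<theta> -` E \<inter> space M"
    then have \<omega>: "\<omega> \<in> space M" "\<theta> \<omega> \<in> E" by auto
    have "\<exists>n. real b < (\<Sum>i=1..n. \<xi> ((T ^^ i) \<omega>))" for b :: nat
    proof -
      obtain b' :: nat where b': "real b + \<bar>\<xi> \<omega>\<bar> \<le> real b'" using real_arch_simple by blast
      with \<omega>(2) obtain n where n: "real b' < (\<Sum>i=1..n. \<xi> ((T ^^ i) (\<theta> \<omega>)))" by (auto simp: E_def)
      then obtain n' where "n = Suc n'" using b' by (cases n) auto
      then have "real b' < \<xi> \<omega> + (\<Sum>i=1..n'. \<xi> ((T ^^ i) \<omega>))"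
        using n unfolding \<open>n = Suc n'\<close> step[OF \<omega>(1)] by blast
      with b' show ?thesis by (intro exI[of _ n']) linarith
    qed
    with \<omega> show "\<omega> \<in> E" by (simp add: E_def)
  next
    fix \<omega> assume "\<omega> \<in> E"
    then have \<omega>: "\<omega> \<in> space M" by (simp add: E_def)
    have "\<exists>n. real b < (\<Sum>i=1..n. \<xi> ((T ^^ i) (\<theta> \<omega>)))" for b :: nat
    proof -
      obtain b' :: nat where b': "real b + \<bar>\<xi> \<omega>\<bar> \<le> real b'" using real_arch_simple by blast
      with \<open>\<omega> \<in> E\<close> obtain n where "real b' < (\<Sum>i=1..n. \<xi> ((T ^^ i) \<omega>))" by (auto simp: E_def)
      with b' step[OF \<omega>, of n] show ?thesis by (intro exI[of _ "Suc n"]) linarith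
    qed
    with \<omega> show "\<omega> \<in> \<theta> -` E \<inter> space M" by (simp add: E_def theta_in_space)
  qed
  with E have "prob E = 0 \<or> prob E = 1" by (rule ergodic)
  moreover have "prob E \<noteq> 1"
  proof
    assume "prob E = 1"
    then have AE_E: "AE \<omega> in M. \<omega> \<in> E" using prob_eq_1[OF E] by simp
    \<comment> \<open>This is max(0, \<open>\<xi>\<close> + L) - L with L =
      \<open>lindley \<xi> n\<close>, so by stationarity its integral is the increment of the mean
      of L. It is dominated by the absolute value of \<open>\<xi>\<close> although the means of L
      are not controlled.\<close>
    let ?d = "\<lambda>n \<omega>. max (- lindley \<xi> n \<omega>) (\<xi> \<omega>)"
    have int: "integrable M (lindley \<xi> n)" for n by (rule integrable_lindley) simp
    then have [measurable]: "lindley \<xi> n \<in> borel_measurable M" for n by auto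
    have pos: "0 \<le> (\<integral>\<omega>. ?d n \<omega> \<partial>M)" for n
    proof -
      have *: "integrable M (\<lambda>\<omega>. max 0 (\<xi> \<omega> + lindley \<xi> n \<omega>))" using int by auto
      have "(\<integral>\<omega>. lindley \<xi> n \<omega> \<partial>M) \<le> (\<integral>\<omega>. lindley \<xi> (Suc n) \<omega> \<partial>M)"
        by (intro integral_mono int lindley_le_Suc)
      also have "\<dots> = (\<integral>\<omega>. max 0 (\<xi> \<omega> + lindley \<xi> n \<omega>) \<partial>M)"
        using integral_comp_T(2)[OF *] by simp
      also have "(\<lambda>\<omega>. max 0 (\<xi> \<omega> + lindley \<xi> n \<omega>)) = (\<lambda>\<omega>. ?d n \<omega> + lindley \<xi> n \<omega>)"
        by (auto simp: max_def fun_eq_iff)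
      also have "(\<integral>\<omega>. ?d n \<omega> + lindley \<xi> n \<omega> \<partial>M) = (\<integral>\<omega>. ?d n \<omega> \<partial>M) + (\<integral>\<omega>. lindley \<xi> n \<omega> \<partial>M)"
        by (intro Bochner_Integration.integral_add integrable_max int) (use int in auto)
      finally show ?thesis by simp
    qed
    have "(\<lambda>n. \<integral>\<omega>. ?d n \<omega> \<partial>M) \<longlonglongrightarrow> (\<integral>\<omega>. \<xi> \<omega> \<partial>M)"
    proof (rule integral_dominated_convergence[where w = "\<lambda>\<omega>. \<bar>\<xi> \<omega>\<bar>"])
      show "AE \<omega> in M. (\<lambda>n. ?d n \<omega>) \<longlonglongrightarrow> \<xi> \<omega>"
        using AE_E
      proof eventually_elim
        fix \<omega> assume "\<omega> \<in> E"
        obtain b :: nat where b: "\<bar>\<xi> \<omega>\<bar> \<le> real b" using real_arch_simple by blast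
        from \<open>\<omega> \<in> E\<close> obtain n where "real b < (\<Sum>i=1..n. \<xi> ((T ^^ i) \<omega>))" by (auto simp: E_def)
        with b sum_le_lindley[of \<xi> \<omega> n] have "- lindley \<xi> n \<omega> \<le> \<xi> \<omega>" by linarith
        then have "?d m \<omega> = \<xi> \<omega>" if "n \<le> m" for m
          using lindley_mono[OF that, of \<xi> \<omega>] by (auto simp: max_def)
        then have "eventually (\<lambda>m. ?d m \<omega> = \<xi> \<omega>) sequentially"
          by (auto simp: eventually_sequentially)
        then show "(\<lambda>n. ?d n \<omega>) \<longlonglongrightarrow> \<xi> \<omega>" by (rule tendsto_eventually)
      qed
      show "AE \<omega> in M. norm (?d n \<omega>) \<le> \<bar>\<xi> \<omega>\<bar>" for n
      proof (intro AE_I2)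
        fix \<omega>
        show "norm (?d n \<omega>) \<le> \<bar>\<xi> \<omega>\<bar>"
          using lindley_nonneg[of \<xi> n \<omega>] by (auto simp: max_def)
      qed
    qed auto
    then have "0 \<le> (\<integral>\<omega>. \<xi> \<omega> \<partial>M)" by (rule LIMSEQ_le_const) (use pos in auto)
    with neg show False by simp
  qed
  ultimately have "prob E = 0" by simp
  then have "AE \<omega> in M. \<omega> \<notin> E"
    using prob_eq_0[OF E] by simp
  with AE_space show ?thesis
  proof eventually_elim
    fix \<omega> assume "\<omega> \<notin> E" "\<omega> \<in> space M"
    then obtain b where "\<forall>n. \<not> real b < (\<Sum>i=1..n. \<xi> ((T ^^ i) \<omega>))" by (auto simp: E_def)
    then show "\<exists>b. \<forall>n. (\<Sum>i=1..n. \<xi> ((T ^^ i) \<omega>)) \<le> b" by (auto simp: not_less)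
  qed
qed

text \<open>The extra term is absorbed into the increments after removing its bounded part,
  which changes their mean by as little as desired.\<close>

lemma AE_perturbed_partial_sums_bounded:
  fixes \<xi> \<eta> :: "'a \<Rightarrow> real"
  assumes \<xi> [simp]: "integrable M \<xi>" and neg: "(\<integral>\<omega>. \<xi> \<omega> \<partial>M) < 0"
    and \<eta> [simp]: "integrable M \<eta>" and nonneg: "\<And>\<omega>. \<omega> \<in> space M \<Longrightarrow> 0 \<le> \<eta> \<omega>"
  shows "AE \<omega> in M. \<exists>b. \<forall>n>0. \<eta> ((T ^^ n) \<omega>) + (\<Sum>i=1..n. \<xi> ((T ^^ i) \<omega>)) \<le> b"
proof -
  have [measurable]: "\<eta> \<in> borel_measurable M" using \<eta> by (rule borel_measurable_integrable)
  let ?e = "\<lambda>K \<omega>. if real K < \<eta> \<omega> then \<eta> \<omega> else 0"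
  have int: "integrable M (?e K)" for K
    by (rule Bochner_Integration.integrable_bound[OF \<eta>]) (auto simp: nonneg)
  have "(\<lambda>K. \<integral>\<omega>. ?e K \<omega> \<partial>M) \<longlonglongrightarrow> (\<integral>\<omega>. 0 \<partial>M)"
  proof (rule integral_dominated_convergence[where w = "\<lambda>\<omega>. \<bar>\<eta> \<omega>\<bar>"])
    show "AE \<omega> in M. (\<lambda>K. ?e K \<omega>) \<longlonglongrightarrow> 0"
    proof (intro AE_I2 tendsto_eventually)
      fix \<omega>
      obtain b :: nat where b: "\<eta> \<omega> \<le> real b" using real_arch_simple by blast
      show "eventually (\<lambda>K. ?e K \<omega> = 0) sequentially"
        unfolding eventually_sequentially by (rule exI[of _ b]) (use b in auto)
    qed
  qed auto
  then have "eventually (\<lambda>K. (\<integral>\<omega>. ?e K \<omega> \<partial>M) < - (\<integral>\<omega>. \<xi> \<omega> \<partial>M)) sequentially"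
    using neg by (intro order_tendstoD) auto
  then obtain K where K: "(\<integral>\<omega>. ?e K \<omega> \<partial>M) < - (\<integral>\<omega>. \<xi> \<omega> \<partial>M)"
    by (auto simp: eventually_sequentially)
  have "(\<integral>\<omega>. \<xi> \<omega> + ?e K \<omega> \<partial>M) < 0"
    using K int[of K] by (subst Bochner_Integration.integral_add) auto
  then have "AE \<omega> in M. \<exists>b. \<forall>n. (\<Sum>i=1..n. \<xi> ((T ^^ i) \<omega>) + ?e K ((T ^^ i) \<omega>)) \<le> b"
    using int[of K] by (intro AE_partial_sums_bounded) auto
  with AE_space show ?thesis
  proof eventually_elim
    fix \<omega> assume \<omega>: "\<omega> \<in> space M"
      and "\<exists>b. \<forall>n. (\<Sum>i=1..n. \<xi> ((T ^^ i) \<omega>) + ?e K ((T ^^ i) \<omega>)) \<le> b"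
    then obtain b where b: "\<And>n. (\<Sum>i=1..n. \<xi> ((T ^^ i) \<omega>) + ?e K ((T ^^ i) \<omega>)) \<le> b" by blast
    have "\<eta> ((T ^^ n) \<omega>) + (\<Sum>i=1..n. \<xi> ((T ^^ i) \<omega>)) \<le> b + real K" if "0 < n" for n
    proof -
      have "\<eta> ((T ^^ n) \<omega>) \<le> ?e K ((T ^^ n) \<omega>) + real K" by auto
      \<comment> \<open>The summation range contains \<open>n\<close> itself because
        \<open>n\<close> is positive, and all terms are nonnegative.\<close>
      also have "?e K ((T ^^ n) \<omega>) \<le> (\<Sum>i=1..n. ?e K ((T ^^ i) \<omega>))"
        using that by (intro member_le_sum) (auto simp: nonneg[OF funpow_T_in_space[OF \<omega>]])
      finally show ?thesis using b[of n] by (simp add: sum.distrib)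
    qed
    then show "\<exists>b. \<forall>n>0. \<eta> ((T ^^ n) \<omega>) + (\<Sum>i=1..n. \<xi> ((T ^^ i) \<omega>)) \<le> b" by blast
  qed
qed

end

section \<open>Coupling from the past\<close>

lemma (in prob_space) indep_vars_prob_Ball:
  assumes indep: "indep_vars N X UNIV" and "finite J" and B: "\<And>j. j \<in> J \<Longrightarrow> B j \<in> sets (N j)"
  shows "prob {\<omega> \<in> space M. \<forall>j\<in>J. X j \<omega> \<in> B j} = (\<Prod>j\<in>J. prob (X j -` B j \<inter> space M))"
proof (cases "J = {}")
  case False
  have "{\<omega> \<in> space M. \<forall>j\<in>J. X j \<omega> \<in> B j} = (\<Inter>j\<in>J. X j -` B j \<inter> space M)"
    using False by auto
  with indep_varsD[OF indep False \<open>finite J\<close> _] B show ?thesis by simp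
qed (simp add: prob_space)

text \<open>A finite index set splits into one slice per sequence. Independence of the sequences
  factors the two cylinder events, and independence within each sequence factors each cylinder. With
  a single family, any two disjoint sets of inputs can be separated.\<close>

lemma (in prob_space) indep_vars_combine:
  fixes X Y :: "'i \<Rightarrow> 'a \<Rightarrow> 'b" and N :: "'b measure"
  assumes X: "indep_vars (\<lambda>_. N) X UNIV" and Y: "indep_vars (\<lambda>_. N) Y UNIV"
    and XY: "indep_var (\<Pi>\<^sub>M n\<in>UNIV. N) (\<lambda>\<omega> n. X n \<omega>) (\<Pi>\<^sub>M n\<in>UNIV. N) (\<lambda>\<omega> n. Y n \<omega>)"
  shows "indep_vars (\<lambda>_. N) (\<lambda>j. if fst j then X (snd j) else Y (snd j)) (UNIV :: (bool \<times> 'i) set)"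
proof -
  let ?V = "\<lambda>j. if fst j then X (snd j) else Y (snd j)"
  have rv: "random_variable N (?V j)" for j
    using X Y by (auto simp: indep_vars_def2)
  have "indep_sets (\<lambda>j. {?V j -` A \<inter> space M |A. A \<in> sets N}) UNIV"
  proof (rule indep_setsI)
    fix A and J :: "(bool \<times> 'i) set"
    assume "finite J" and "\<forall>j\<in>J. A j \<in> {?V j -` A \<inter> space M |A. A \<in> sets N}" and "J \<noteq> {}"
    then have "\<forall>j\<in>J. \<exists>B. B \<in> sets N \<and> A j = ?V j -` B \<inter> space M" by blast
    then obtain B where B: "\<And>j. j \<in> J \<Longrightarrow> B j \<in> sets N" "\<And>j. j \<in> J \<Longrightarrow> A j = ?V j -` B j \<inter> space M"
      by metis
    define I where "I b = {n. (b, n) \<in> J}" for b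
    have fin: "finite (I b)" for b
      using finite_vimageI[OF \<open>finite J\<close>, of "Pair b"] by (simp add: I_def vimage_def inj_on_def)
    define F where "F b = {f \<in> space (\<Pi>\<^sub>M n\<in>(UNIV::'i set). N). \<forall>n\<in>I b. f n \<in> B (b, n)}" for b
    have F: "F b \<in> sets (\<Pi>\<^sub>M n\<in>UNIV. N)" for b
      unfolding F_def using fin B(1)
      by (intro sets.sets_Collect_finite_All sets_Collect_single') (auto simp: I_def)
    have J: "J = Pair True ` I True \<union> Pair False ` I False"
    proof (intro equalityI subsetI)
      fix j assume "j \<in> J"
      then show "j \<in> Pair True ` I True \<union> Pair False ` I False"
        by (cases j; cases "fst j") (auto simp: I_def)
    qed (auto simp: I_def)
    have V: "(\<forall>j\<in>J. ?V j \<omega> \<in> B j) \<longleftrightarrow>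
        (\<forall>n\<in>I True. X n \<omega> \<in> B (True, n)) \<and> (\<forall>n\<in>I False. Y n \<omega> \<in> B (False, n))" for \<omega>
      by (subst J) (simp add: ball_Un)
    have "(\<Inter>j\<in>J. A j) = (\<Inter>j\<in>J. ?V j -` B j \<inter> space M)"
      by (intro INF_cong refl B(2))
    also have "\<dots> = {\<omega> \<in> space M. \<forall>j\<in>J. ?V j \<omega> \<in> B j}"
      using \<open>J \<noteq> {}\<close> by blast
    also have "\<dots> = (\<lambda>\<omega>. (\<lambda>n. X n \<omega>, \<lambda>n. Y n \<omega>)) -` (F True \<times> F False) \<inter> space M"
      using rv[of "(True, _)", THEN measurable_space] rv[of "(False, _)", THEN measurable_space]
      unfolding V by (auto simp: F_def space_PiM PiE_iff)
    also have "prob \<dots> = prob ((\<lambda>\<omega> n. X n \<omega>) -` F True \<inter> space M) * prob ((\<lambda>\<omega> n. Y n \<omega>) -` F False \<inter> space M)"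
      by (rule indep_varD[OF XY F F])
    also have "(\<lambda>\<omega> n. X n \<omega>) -` F True \<inter> space M = {\<omega> \<in> space M. \<forall>n\<in>I True. X n \<omega> \<in> B (True, n)}"
      using rv[of "(True, _)", THEN measurable_space] by (auto simp: F_def space_PiM PiE_iff)
    \<comment> \<open>The slice may be empty, a case that \<open>indep_vars_prob_Ball\<close>
      includes.\<close>
    also have "prob \<dots> = (\<Prod>n\<in>I True. prob (A (True, n)))"
      using B by (subst indep_vars_prob_Ball[OF X fin]) (auto simp: I_def)
    also have "(\<lambda>\<omega> n. Y n \<omega>) -` F False \<inter> space M = {\<omega> \<in> space M. \<forall>n\<in>I False. Y n \<omega> \<in> B (False, n)}"
      using rv[of "(False, _)", THEN measurable_space] by (auto simp: F_def space_PiM PiE_iff)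
    also have "prob \<dots> = (\<Prod>n\<in>I False. prob (A (False, n)))"
      using B by (subst indep_vars_prob_Ball[OF Y fin]) (auto simp: I_def)
    also have "(\<Prod>n\<in>I True. prob (A (True, n))) * (\<Prod>n\<in>I False. prob (A (False, n))) =
        (\<Prod>j\<in>Pair True ` I True \<union> Pair False ` I False. prob (A j))"
      by (subst prod.union_disjoint) (auto simp: fin prod.reindex inj_on_def)
    also note J [symmetric]
    finally show "prob (\<Inter>j\<in>J. A j) = (\<Prod>j\<in>J. prob (A j))" .
  qed (use measurable_sets[OF rv] in blast)
  with rv show ?thesis by (simp add: indep_vars_def2)
qed

locale gi_gi_queue = ergodic_automorphism M \<theta> for M :: "'a measure" and \<theta> +
  fixes \<sigma> \<tau> :: "'a \<Rightarrow> real" and S p :: nat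
  assumes integrable_\<sigma>: "integrable M \<sigma>" and integrable_\<tau>: "integrable M \<tau>"
    and \<sigma>_nonneg: "\<And>\<omega>. \<omega> \<in> space M \<Longrightarrow> 0 \<le> \<sigma> \<omega>" and \<tau>_nonneg: "\<And>\<omega>. \<omega> \<in> space M \<Longrightarrow> 0 \<le> \<tau> \<omega>"
    and p_pos: "0 < p" and p_less: "p < S"
    and GI_GI: "GI_GI M \<theta> \<sigma> \<tau>"
    and unbounded: "\<not> bounded (measure_support (distr M borel \<tau>))"
    and traffic: "integral\<^sup>L M \<sigma> * measure M {\<omega> \<in> space M. 0 < Z M \<theta> \<sigma> \<tau> p \<omega>} <
           (real S - real p) * integral\<^sup>L M \<tau>"
begin

abbreviation workload :: "nat \<Rightarrow> 'a \<Rightarrow> real list" where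
  "workload m \<omega> \<equiv> loynes p S (\<lambda>n. \<sigma> ((T ^^ n) \<omega>)) (\<lambda>n. \<tau> ((T ^^ n) \<omega>)) m 0"

lemma measurable_\<sigma> [measurable]: "\<sigma> \<in> borel_measurable M"
  using integrable_\<sigma> by auto

lemma measurable_\<tau> [measurable]: "\<tau> \<in> borel_measurable M"
  using integrable_\<tau> by auto

lemma workload_funpow_T:
  "workload m ((T ^^ k) \<omega>) = loynes p S (\<lambda>n. \<sigma> ((T ^^ n) \<omega>)) (\<lambda>n. \<tau> ((T ^^ n) \<omega>)) m k"
  using loynes_shift[of p S "\<lambda>n. \<sigma> ((T ^^ n) \<omega>)" "\<lambda>n. \<tau> ((T ^^ n) \<omega>)" m 0 k]
  by (simp add: funpow_add)

lemma workload_theta: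
  assumes "\<omega> \<in> space M"
  shows "workload (Suc m) (\<theta> \<omega>) = G p (\<sigma> \<omega>) (\<tau> \<omega>) (workload m \<omega>)"
  using workload_funpow_T[where m = m and k = "Suc 0" and \<omega> = "\<theta> \<omega>"] by (simp add: T_theta[OF assms])

lemma measurable_workload_nth: "i < S \<Longrightarrow> (\<lambda>\<omega>. workload m \<omega> ! i) \<in> borel_measurable M"
  by (intro borel_measurable_loynes_nth) auto

definition busy :: "'a \<Rightarrow> bool" where
  "busy \<omega> \<longleftrightarrow> (\<exists>k\<ge>p. 0 < \<sigma> ((T ^^ k) \<omega>) - (\<Sum>i=1..k. \<tau> ((T ^^ i) \<omega>)))"

lemma Z_pos_iff: "0 < Z M \<theta> \<sigma> \<tau> p \<omega> \<longleftrightarrow> busy \<omega>"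
  by (auto simp: busy_def Z_def iter_minus less_max_iff_disj less_SUP_iff)

definition input :: "bool \<times> int \<Rightarrow> 'a \<Rightarrow> real" where
  "input j \<omega> = (if fst j then \<tau> (iter M \<theta> (snd j) \<omega>) else \<sigma> (iter M \<theta> (snd j) \<omega>))"

lemma indep_input: "indep_vars (\<lambda>_. borel) input UNIV"
proof -
  have "indep_vars (\<lambda>_. borel) (\<lambda>j. if fst j then (\<lambda>\<omega>. \<tau> (iter M \<theta> (snd j) \<omega>)) else (\<lambda>\<omega>. \<sigma> (iter M \<theta> (snd j) \<omega>))) UNIV"
    using GI_GI by (intro indep_vars_combine) (auto simp: GI_GI_def iid_def)
  also have "(\<lambda>j. if fst j then (\<lambda>\<omega>. \<tau> (iter M \<theta> (snd j) \<omega>)) else (\<lambda>\<omega>. \<sigma> (iter M \<theta> (snd j) \<omega>))) = input"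
    by (auto simp: input_def fun_eq_iff)
  finally show ?thesis .
qed

lemma input_past: "input (b, - int k) \<omega> = (if b then \<tau> ((T ^^ k) \<omega>) else \<sigma> ((T ^^ k) \<omega>))"
  by (simp add: input_def iter_minus)

lemma input_present: "input (b, 0) \<omega> = (if b then \<tau> \<omega> else \<sigma> \<omega>)"
  using input_past[of b 0 \<omega>] by simp

text \<open>As \<open>p\<close> is positive, \<open>busy\<close> reads only inputs of strictly
  negative index, whereas \<open>\<sigma>\<close> is the service input of index 0.\<close>

lemma indep_service_busy: "indep_var borel \<sigma> borel (\<lambda>\<omega>. if busy \<omega> then 1 else 0 :: real)"
proof -
  define A where "A = (UNIV :: bool set) \<times> {n::int. n < 0}"
  \<comment> \<open>The value 0 at \<open>k = 0\<close> is a dummy, since \<open>A\<close> has no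
    index 0; \<open>Y\<close> reads only positive \<open>k\<close>.\<close>
  define s where "s b k g = (if 0 < k then g (b, - int k) else 0 :: real)" for b k and g :: "bool \<times> int \<Rightarrow> real"
  have s [measurable]: "s b k \<in> borel_measurable (Pi\<^sub>M A (\<lambda>_. borel))" for b k
    unfolding s_def by (cases "0 < k") (auto simp: A_def intro!: measurable_component_singleton)
  define Y where "Y g = (if \<exists>k\<ge>p. 0 < s False k g - (\<Sum>i=1..k. s True i g) then 1 else 0 :: real)" for g
  have Y: "Y \<in> borel_measurable (Pi\<^sub>M A (\<lambda>_. borel))"
    unfolding Y_def by measurable
  have "indep_var borel ((\<lambda>g. g (False, 0)) \<circ> (\<lambda>\<omega>. restrict (\<lambda>j. input j \<omega>) {(False, 0)}))
      borel (Y \<circ> (\<lambda>\<omega>. restrict (\<lambda>j. input j \<omega>) A))"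
    by (rule indep_var_compose[OF indep_var_restrict[OF indep_input]])
       (auto simp: A_def intro!: measurable_component_singleton Y[unfolded A_def])
  moreover have "(\<lambda>g. g (False, 0)) \<circ> (\<lambda>\<omega>. restrict (\<lambda>j. input j \<omega>) {(False, 0)}) = \<sigma>"
    by (auto simp: fun_eq_iff input_present)
  moreover have "Y \<circ> (\<lambda>\<omega>. restrict (\<lambda>j. input j \<omega>) A) = (\<lambda>\<omega>. if busy \<omega> then 1 else 0)"
  proof (rule ext)
    fix \<omega>
    have s_eq: "s b k (restrict (\<lambda>j. input j \<omega>) A) = (if b then \<tau> ((T ^^ k) \<omega>) else \<sigma> ((T ^^ k) \<omega>))"
      if "0 < k" for b k
      using that by (auto simp: s_def A_def input_past)
    have "0 < s False k (restrict (\<lambda>j. input j \<omega>) A) - (\<Sum>i=1..k. s True i (restrict (\<lambda>j. input j \<omega>) A))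
        \<longleftrightarrow> 0 < \<sigma> ((T ^^ k) \<omega>) - (\<Sum>i=1..k. \<tau> ((T ^^ i) \<omega>))" if "p \<le> k" for k
      using that p_pos by (simp add: s_eq)
    then show "(Y \<circ> (\<lambda>\<omega>. restrict (\<lambda>j. input j \<omega>) A)) \<omega> = (if busy \<omega> then 1 else 0)"
      by (auto simp: Y_def busy_def)
  qed
  ultimately show ?thesis by simp
qed

lemma measurable_busy [measurable]: "Measurable.pred M busy"
  unfolding busy_def by measurable

lemma integral_served_when_busy:
  "integrable M (\<lambda>\<omega>. if busy \<omega> then \<sigma> \<omega> else 0)"
  "(\<integral>\<omega>. (if busy \<omega> then \<sigma> \<omega> else 0) \<partial>M) =
     integral\<^sup>L M \<sigma> * measure M {\<omega> \<in> space M. 0 < Z M \<theta> \<sigma> \<tau> p \<omega>}"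
proof -
  let ?B = "\<lambda>\<omega>. if busy \<omega> then 1 else 0 :: real"
  have ind: "(\<integral>\<omega>. ?B \<omega> \<partial>M) = (\<integral>\<omega>. indicator {\<omega> \<in> space M. busy \<omega>} \<omega> \<partial>M)"
    by (intro Bochner_Integration.integral_cong) auto
  have int: "integrable M ?B"
    by (rule integrable_const_bound[where B = 1]) auto
  have eq: "(\<lambda>\<omega>. if busy \<omega> then \<sigma> \<omega> else 0) = (\<lambda>\<omega>. \<sigma> \<omega> * ?B \<omega>)" by auto
  show "integrable M (\<lambda>\<omega>. if busy \<omega> then \<sigma> \<omega> else 0)"
    unfolding eq by (rule indep_var_integrable[OF indep_service_busy integrable_\<sigma> int])
  show "(\<integral>\<omega>. (if busy \<omega> then \<sigma> \<omega> else 0) \<partial>M) =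
     integral\<^sup>L M \<sigma> * measure M {\<omega> \<in> space M. 0 < Z M \<theta> \<sigma> \<tau> p \<omega>}"
    unfolding eq indep_var_lebesgue_integral[OF indep_service_busy integrable_\<sigma> int]
    by (simp add: ind Z_pos_iff)
qed

section \<open>Almost sure boundedness of the workloads\<close>

lemma AE_workload_bounded: "AE \<omega> in M. \<exists>b. \<forall>m. workload m \<omega> ! (S - 1) \<le> b"
proof -
  define q where "q = real S - real p"
  have q: "1 \<le> q" using p_less by (simp add: q_def)
  define \<rho> where "\<rho> = (\<integral>\<omega>. (if busy \<omega> then \<sigma> \<omega> else 0) \<partial>M)"
  define d where "d = integral\<^sup>L M \<tau> - \<rho> / q"
  \<comment> \<open>With this choice \<open>q * \<epsilon>\<close> is half the drift
    \<open>d\<close>, so adding it to the increments leaves the mean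
    \<open>- (q * \<epsilon>)\<close>.\<close>
  define \<epsilon> where "\<epsilon> = d / (2 * q)"
  have "0 < d" using traffic q by (simp add: d_def \<rho>_def integral_served_when_busy q_def field_simps)
  then have \<epsilon>: "0 < \<epsilon>" using q by (simp add: \<epsilon>_def)
  let ?a = "\<lambda>\<omega>. if busy \<omega> then \<sigma> \<omega> else 0"
  let ?c = "\<lambda>\<omega>. ?a \<omega> / q - \<tau> \<omega> + \<epsilon>"
  \<comment> \<open>The surplus \<open>(q - 1) * \<epsilon>\<close> over \<open>?c\<close> sums to
    the term \<open>(q - 1) * \<epsilon> * real n\<close> required by
    \<open>loynes_bound\<close>.\<close>
  let ?c' = "\<lambda>\<omega>. ?a \<omega> / q - \<tau> \<omega> + q * \<epsilon>"
  have int: "integrable M (\<lambda>\<omega>. ?a \<omega> / q)"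
    by (intro Bochner_Integration.integrable_divide integral_served_when_busy) 
  have "(\<integral>\<omega>. ?c' \<omega> \<partial>M) = \<rho> / q - integral\<^sup>L M \<tau> + q * \<epsilon>"
    using int integrable_\<tau> by (simp add: \<rho>_def prob_space)
  also have "\<dots> = q * \<epsilon> - d" by (simp add: d_def)
  also have "\<dots> = - (q * \<epsilon>)" using q by (simp add: \<epsilon>_def)
  also have "\<dots> < 0" using \<epsilon> q by simp
  finally have "AE \<omega> in M. \<exists>b. \<forall>n>0. 2 * q * (\<sigma> ((T ^^ n) \<omega>) + \<tau> ((T ^^ n) \<omega>)) + (\<Sum>i=1..n. ?c' ((T ^^ i) \<omega>)) \<le> b"
    using int integrable_\<sigma> integrable_\<tau> q \<sigma>_nonneg \<tau>_nonneg
    by (intro AE_perturbed_partial_sums_bounded) auto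
  \<comment> \<open>Constant increments \<open>- \<epsilon>\<close> turn the lemma into linear
    growth control of the service times, from which \<open>D\<close> is taken.\<close>
  moreover have "AE \<omega> in M. \<exists>b. \<forall>n>0. \<sigma> ((T ^^ n) \<omega>) + (\<Sum>i=1..n. - \<epsilon>) \<le> b"
    using integrable_\<sigma> \<sigma>_nonneg \<epsilon> 
    by (intro AE_perturbed_partial_sums_bounded[where \<xi> = "\<lambda>_. - \<epsilon>"]) (auto simp: prob_space)
  ultimately show ?thesis using AE_space
  proof eventually_elim
    fix \<omega> assume \<omega>: "\<omega> \<in> space M"
    assume "\<exists>b. \<forall>n>0. 2 * q * (\<sigma> ((T ^^ n) \<omega>) + \<tau> ((T ^^ n) \<omega>)) + (\<Sum>i=1..n. ?c' ((T ^^ i) \<omega>)) \<le> b"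
    then obtain b where b: "\<And>n. 0 < n \<Longrightarrow>
      2 * q * (\<sigma> ((T ^^ n) \<omega>) + \<tau> ((T ^^ n) \<omega>)) + (\<Sum>i=1..n. ?c' ((T ^^ i) \<omega>)) \<le> b" by blast
    assume "\<exists>b. \<forall>n>0. \<sigma> ((T ^^ n) \<omega>) + (\<Sum>i=1..n. - \<epsilon>) \<le> b"
    then obtain b' where b': "\<And>n. 0 < n \<Longrightarrow> \<sigma> ((T ^^ n) \<omega>) \<le> b' + \<epsilon> * real n"
      by (auto simp: algebra_simps)
    define D where "D = max 0 b'"
    define X where "X = max 0 (b + (q - 1) * D)"
    let ?s = "\<lambda>n. \<sigma> ((T ^^ n) \<omega>)" and ?t = "\<lambda>n. \<tau> ((T ^^ n) \<omega>)"
    have a: "?a ((T ^^ n) \<omega>) = (if \<exists>k\<ge>p. 0 < ?s (n + k) - (\<Sum>j=1..k. ?t (n + j)) then ?s n else 0)" for n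
    proof -
      have "(T ^^ k) ((T ^^ n) \<omega>) = (T ^^ (n + k)) \<omega>" for k
        by (metis add.commute comp_apply funpow_add)
      then show ?thesis by (simp add: busy_def)
    qed
    have X: "2 * q * (?s n + ?t n) + (q - 1) * (D + \<epsilon> * real n) + (\<Sum>i=1..n. ?c ((T ^^ i) \<omega>)) \<le> X"
      if "0 < n" for n
    proof -
      have "(\<Sum>i=1..n. ?c' ((T ^^ i) \<omega>)) = (\<Sum>i=1..n. ?c ((T ^^ i) \<omega>) + (q - 1) * \<epsilon>)"
        by (intro sum.cong) (auto simp: algebra_simps)
      also have "\<dots> = (\<Sum>i=1..n. ?c ((T ^^ i) \<omega>)) + (q - 1) * (\<epsilon> * real n)"
        by (simp add: sum.distrib)
      finally show ?thesis using b[OF that] by (simp add: X_def algebra_simps)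
    qed
    have "workload m \<omega> ! (S - 1) \<le> X + D" for m
    proof -
      have "workload m \<omega> ! (S - 1) \<le> X - (\<Sum>i=1..0. ?c ((T ^^ i) \<omega>)) + D + \<epsilon> * real 0"
        unfolding a
      proof (rule loynes_bound[where p = p and S = S and s = ?s and t = ?t and D = D and X = X and \<epsilon> = \<epsilon>,
            folded q_def, THEN conjunct1])
        show "?s n \<le> D + \<epsilon> * real n" if "0 < n" for n
          using b'[OF that] by (simp add: D_def)
      qed (use p_pos p_less \<epsilon> X[unfolded a] in \<open>auto simp: D_def X_def \<sigma>_nonneg \<tau>_nonneg funpow_T_in_space[OF \<omega>]\<close>)
      then show ?thesis by simp
    qed
    then show "\<exists>b. \<forall>m. workload m \<omega> ! (S - 1) \<le> b" by blast
  qed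
qed

lemma prob_interarrival_large: "0 < prob {\<omega> \<in> space M. y < \<tau> \<omega>}" if "0 \<le> y"
proof -
  obtain x where x: "x \<in> measure_support (distr M borel \<tau>)" "y < \<bar>x\<bar>"
    using unbounded by (auto simp: bounded_iff not_le)
  have "open {x::real. y < \<bar>x\<bar>}" by (intro open_Collect_less continuous_intros)
  with x have "0 < emeasure (distr M borel \<tau>) {x. y < \<bar>x\<bar>}" by (auto simp: measure_support_def)
  also have "\<dots> = emeasure M (\<tau> -` {x. y < \<bar>x\<bar>} \<inter> space M)"
    by (rule emeasure_distr) auto
  also have "\<tau> -` {x. y < \<bar>x\<bar>} \<inter> space M = {\<omega> \<in> space M. y < \<tau> \<omega>}"
    using \<tau>_nonneg by auto
  finally show ?thesis by (simp add: emeasure_eq_measure)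
qed

text \<open>An interarrival time this large empties the system whatever its past,
  so the present workload forgets everything before it.\<close>

definition renewal :: "real \<Rightarrow> 'a set" where
  "renewal y = {\<omega> \<in> space M. (\<forall>m. workload m \<omega> ! (S - 1) \<le> y) \<and> \<sigma> \<omega> \<le> y \<and> 2 * y < \<tau> \<omega>}"

lemma measurable_workload_max [measurable]: "(\<lambda>\<omega>. workload m \<omega> ! (S - 1)) \<in> borel_measurable M"
  using p_less by (intro measurable_workload_nth) auto

lemma renewal_sets [measurable]: "renewal y \<in> sets M"
  unfolding renewal_def by measurable

text \<open>The workloads and the service time have an almost surely finite common bound, so some
  integer \<open>y\<close> bounds them with positive probability. That event does not involve the
  present interarrival time, hence the probabilities multiply.\<close>

lemma ex_renewal: "\<exists>y. 0 < prob (renewal y)"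
proof -
  let ?P = "\<lambda>y \<omega>. (\<forall>m. workload m \<omega> ! (S - 1) \<le> y) \<and> \<sigma> \<omega> \<le> y"
  have "\<exists>y::nat. 0 < prob {\<omega> \<in> space M. ?P (real y) \<omega>}"
  proof (rule ccontr)
    assume "\<not> ?thesis"
    then have "prob {\<omega> \<in> space M. ?P (real y) \<omega>} = 0" for y :: nat
      using measure_nonneg[of M] by (meson antisym not_less)
    then have "AE \<omega> in M. \<not> ?P (real y) \<omega>" for y :: nat
      by (subst (asm) prob_Collect_eq_0) measurable
    then have "AE \<omega> in M. \<forall>y::nat. \<not> ?P (real y) \<omega>"
      by (simp add: AE_all_countable)
    with AE_workload_bounded have "AE \<omega> in M. False"
    proof eventually_elim
      fix \<omega> assume "\<exists>b. \<forall>m. workload m \<omega> ! (S - 1) \<le> b" and neg: "\<forall>y::nat. \<not> ?P (real y) \<omega>"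
      then obtain b where b: "\<And>m. workload m \<omega> ! (S - 1) \<le> b" by blast
      obtain y :: nat where "max b (\<sigma> \<omega>) \<le> real y" using real_arch_simple by blast
      then have "?P (real y) \<omega>" using b by (auto intro: order_trans)
      with neg show False by blast
    qed
    then show False by simp
  qed
  then obtain y :: nat where y: "0 < prob {\<omega> \<in> space M. ?P (real y) \<omega>}" by blast
  \<comment> \<open>The strict past together with the present service time; the one coordinate to be
    separated from it is \<open>(True, 0)\<close>, the present interarrival time.\<close>
  define A where "A = insert (False, 0) ((UNIV :: bool set) \<times> {n::int. n < 0})"
  define s where "s b k g = (if 0 < k then g (b, - int k) else 0 :: real)" for b k and g :: "bool \<times> int \<Rightarrow> real"
  have s [measurable]: "s b k \<in> borel_measurable (Pi\<^sub>M A (\<lambda>_. borel))" for b k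
    unfolding s_def by (cases "0 < k") (auto simp: A_def intro!: measurable_component_singleton)
  have [measurable]: "(\<lambda>g. loynes p S (\<lambda>k. s False k g) (\<lambda>k. s True k g) m 0 ! (S - 1))
      \<in> borel_measurable (Pi\<^sub>M A (\<lambda>_. borel))" for m
    using p_less by (intro borel_measurable_loynes_nth s) auto
  have [measurable]: "(\<lambda>g. g (False, 0)) \<in> borel_measurable (Pi\<^sub>M A (\<lambda>_. borel))"
    by (intro measurable_component_singleton) (simp add: A_def)
  define E where "E = {g \<in> space (Pi\<^sub>M A (\<lambda>_. borel :: real measure)).
    (\<forall>m. loynes p S (\<lambda>k. s False k g) (\<lambda>k. s True k g) m 0 ! (S - 1) \<le> real y) \<and> g (False, 0) \<le> real y}"
  define F where "F = {g \<in> space (Pi\<^sub>M {(True, 0::int)} (\<lambda>_. borel :: real measure)). 2 * real y < g (True, 0)}"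
  have E: "E \<in> sets (Pi\<^sub>M A (\<lambda>_. borel))" unfolding E_def by measurable
  have F: "F \<in> sets (Pi\<^sub>M {(True, 0)} (\<lambda>_. borel))" unfolding F_def by measurable
  have indep: "indep_var (Pi\<^sub>M A (\<lambda>_. borel)) (\<lambda>\<omega>. restrict (\<lambda>j. input j \<omega>) A)
      (Pi\<^sub>M {(True, 0)} (\<lambda>_. borel)) (\<lambda>\<omega>. restrict (\<lambda>j. input j \<omega>) {(True, 0)})"
    by (rule indep_var_restrict[OF indep_input]) (auto simp: A_def)
  have past: "loynes p S (\<lambda>k. s False k (restrict (\<lambda>j. input j \<omega>) A))
      (\<lambda>k. s True k (restrict (\<lambda>j. input j \<omega>) A)) m 0 = workload m \<omega>" for m \<omega>
    by (intro loynes_cong) (auto simp: s_def A_def input_past)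
  have E_iff: "restrict (\<lambda>j. input j \<omega>) A \<in> E \<longleftrightarrow> ?P (real y) \<omega>" for \<omega>
    unfolding E_def mem_Collect_eq past by (simp add: space_PiM A_def input_present)
  have F_iff: "restrict (\<lambda>j. input j \<omega>) {(True, 0)} \<in> F \<longleftrightarrow> 2 * real y < \<tau> \<omega>" for \<omega>
    by (simp add: F_def space_PiM input_present)
  have "prob (renewal (real y)) = prob ((\<lambda>\<omega>. (restrict (\<lambda>j. input j \<omega>) A, restrict (\<lambda>j. input j \<omega>) {(True, 0)}))
      -` (E \<times> F) \<inter> space M)"
    by (intro arg_cong[where f = prob]) (auto simp: renewal_def E_iff F_iff)
  also have "\<dots> = prob ((\<lambda>\<omega>. restrict (\<lambda>j. input j \<omega>) A) -` E \<inter> space M) *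
      prob ((\<lambda>\<omega>. restrict (\<lambda>j. input j \<omega>) {(True, 0)}) -` F \<inter> space M)"
    by (rule indep_varD[OF indep E F])
  also have "(\<lambda>\<omega>. restrict (\<lambda>j. input j \<omega>) A) -` E \<inter> space M = {\<omega> \<in> space M. ?P (real y) \<omega>}"
    by (auto simp: E_iff)
  also have "(\<lambda>\<omega>. restrict (\<lambda>j. input j \<omega>) {(True, 0)}) -` F \<inter> space M = {\<omega> \<in> space M. 2 * real y < \<tau> \<omega>}"
    by (auto simp: F_iff)
  finally have "0 < prob (renewal (real y))"
    using y prob_interarrival_large[of "2 * real y"] by simp
  then show ?thesis ..
qed

section \<open>Coupling and the stationary solution\<close>

definition coupled :: "'a \<Rightarrow> bool" where
  "coupled \<omega> \<longleftrightarrow> (\<exists>N. \<forall>m\<ge>N. workload m \<omega> = workload N \<omega>)"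

lemma AE_coupled: "AE \<omega> in M. coupled \<omega>"
proof -
  obtain y where "0 < prob (renewal y)" using ex_renewal ..
  from AE_recurrence[OF renewal_sets this] AE_space show ?thesis
  proof eventually_elim
    fix \<omega> assume \<omega>: "\<omega> \<in> space M" and "\<exists>k\<ge>1. (T ^^ k) \<omega> \<in> renewal y"
    then obtain k where k: "(T ^^ Suc k) \<omega> \<in> renewal y"
      by (metis One_nat_def Suc_le_D)
    let ?s = "\<lambda>n. \<sigma> ((T ^^ n) \<omega>)" and ?t = "\<lambda>n. \<tau> ((T ^^ n) \<omega>)"
    have "loynes p S ?s ?t (Suc m) k = replicate S 0" for m
    proof -
      \<comment> \<open>Of the threshold \<open>2 * y\<close>, one \<open>y\<close> covers the
        largest workload found on arrival and the other the customer's own service.\<close>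
      from k have "loynes p S ?s ?t m (Suc k) ! (S - 1) \<le> y" "?s (Suc k) \<le> y" "2 * y < ?t (Suc k)"
        unfolding renewal_def mem_Collect_eq workload_funpow_T by blast+
      then show ?thesis
        unfolding loynes.simps using p_less \<sigma>_nonneg[OF funpow_T_in_space[OF \<omega>, of "Suc k"]]
        by (intro G_eq_replicate_0 loynes_in_ordered_orthant) linarith+
    qed
    then have reset: "workload (Suc (m + k)) \<omega> = workload k \<omega>" for m
      by (rule loynes_eq_of_reset) simp
    have "workload m \<omega> = workload (Suc k) \<omega>" if "Suc k \<le> m" for m
      using reset[of "m - Suc k"] reset[of 0] that by simp
    then show "coupled \<omega>" unfolding coupled_def by blast
  qed
qed

lemma measurable_coupled [measurable]: "Measurable.pred M coupled"
proof -
  have [measurable]: "Measurable.pred M (\<lambda>\<omega>. workload m \<omega> = workload N \<omega>)" for m N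
  proof -
    have "(\<lambda>\<omega>. workload m \<omega> = workload N \<omega>) = (\<lambda>\<omega>. \<forall>i\<in>{..<S}. workload m \<omega> ! i = workload N \<omega> ! i)"
      by (auto simp: fun_eq_iff list_eq_iff_nth_eq)
    moreover have "Measurable.pred M (\<lambda>\<omega>. workload m \<omega> ! i = workload N \<omega> ! i)" if "i < S" for i
      using measurable_workload_nth[OF that, of m, measurable] measurable_workload_nth[OF that, of N, measurable]
      by measurable
    ultimately show ?thesis by (auto intro!: pred_intros_finite)
  qed
  show ?thesis unfolding coupled_def by measurable
qed

text \<open>A coordinatewise \<open>lim\<close> makes measurability immediate. The default 0 outside
  \<open>coupled\<close> makes \<open>W\<close> the zero vector there, so it lies in the ordered
  orthant everywhere and not only almost everywhere.\<close>

definition W :: "'a \<Rightarrow> real list" where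
  "W \<omega> = map (\<lambda>i. lim (\<lambda>m. if coupled \<omega> then workload m \<omega> ! i else 0)) [0..<S]"

lemma W_eq:
  assumes "\<And>m. N \<le> m \<Longrightarrow> workload m \<omega> = u"
  shows "W \<omega> = u"
proof (rule nth_equalityI)
  have "coupled \<omega>" unfolding coupled_def using assms by (intro exI[of _ N]) auto
  have u: "u = workload N \<omega>" using assms[of N] by simp
  then show "length (W \<omega>) = length u" by (simp add: W_def)
  fix i assume "i < length (W \<omega>)"
  have "(\<lambda>m. workload m \<omega> ! i) \<longlonglongrightarrow> u ! i"
    by (rule tendsto_eventually) (use assms in \<open>auto simp: eventually_sequentially\<close>)
  with \<open>coupled \<omega>\<close> \<open>i < length (W \<omega>)\<close> show "W \<omega> ! i = u ! i"
    by (simp add: W_def limI)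
qed

lemma random_vector_W: "random_vector M S W"
  unfolding random_vector_def
proof (intro conjI ballI allI impI)
  fix i assume i: "i < S"
  note [measurable] = measurable_workload_nth[OF i]
  have "(\<lambda>\<omega>. lim (\<lambda>m. if coupled \<omega> then workload m \<omega> ! i else 0)) \<in> borel_measurable M"
    by measurable
  then show "(\<lambda>\<omega>. W \<omega> ! i) \<in> borel_measurable M" using i by (simp add: W_def cong: if_cong)
qed (simp add: W_def)

lemma W_in_ordered_orthant: "W \<omega> \<in> ordered_orthant S"
proof (cases "coupled \<omega>")
  case True
  then obtain N where "\<And>m. N \<le> m \<Longrightarrow> workload m \<omega> = workload N \<omega>" by (auto simp: coupled_def)
  from W_eq[OF this] show ?thesis by (simp add: loynes_in_ordered_orthant)
next
  case False
  then have "W \<omega> = replicate S 0" by (simp add: W_def map_replicate_const)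
  then show ?thesis by (simp add: ordered_orthant_def)
qed

lemma AE_W_theta: "AE \<omega> in M. W (\<theta> \<omega>) = G p (\<sigma> \<omega>) (\<tau> \<omega>) (W \<omega>)"
  using AE_coupled AE_space
proof eventually_elim
  fix \<omega> assume "coupled \<omega>" and \<omega>: "\<omega> \<in> space M"
  then obtain N where N: "\<And>m. N \<le> m \<Longrightarrow> workload m \<omega> = workload N \<omega>" by (auto simp: coupled_def)
  \<comment> \<open>A run of m steps seen at \<open>\<omega>\<close> is a run of m + 1 steps seen at
    \<open>\<theta> \<omega>\<close>, hence the threshold \<open>Suc N\<close>.\<close>
  have "workload m (\<theta> \<omega>) = G p (\<sigma> \<omega>) (\<tau> \<omega>) (workload N \<omega>)" if "Suc N \<le> m" for m
    using that workload_theta[OF \<omega>, of "m - 1"] N[of "m - 1"] by (cases m) auto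
  then have "W (\<theta> \<omega>) = G p (\<sigma> \<omega>) (\<tau> \<omega>) (workload N \<omega>)" by (rule W_eq)
  also have "workload N \<omega> = W \<omega>" using W_eq[OF N] by simp
  finally show "W (\<theta> \<omega>) = G p (\<sigma> \<omega>) (\<tau> \<omega>) (W \<omega>)" .
qed

end

theorem theorem1:
  fixes M :: "'a measure" and \<theta> :: "'a \<Rightarrow> 'a" and \<sigma> \<tau> :: "'a \<Rightarrow> real" and S p :: nat
  assumes "ergodic_automorphism M \<theta>"
    and "integrable M \<sigma>" and "integrable M \<tau>"
    and "\<And>\<omega>. \<omega> \<in> space M \<Longrightarrow> 0 \<le> \<sigma> \<omega>" and "\<And>\<omega>. \<omega> \<in> space M \<Longrightarrow> 0 \<le> \<tau> \<omega>"
    and "measure M {\<omega> \<in> space M. 0 < \<tau> \<omega>} = 1"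
    and "2 \<le> S" and "p \<in> {1..S - 1}"
    and "GI_GI M \<theta> \<sigma> \<tau>"
    and "\<not> bounded (measure_support (distr M borel \<tau>))"
    and "integral\<^sup>L M \<sigma> * measure M {\<omega> \<in> space M. 0 < Z M \<theta> \<sigma> \<tau> p \<omega>} <
           (real S - real p) * integral\<^sup>L M \<tau>"
    and "0 < measure M {\<omega> \<in> space M. Z M \<theta> \<sigma> \<tau> p \<omega> = 0}"
  shows "\<exists>W. random_vector M S W \<and>
           (\<forall>\<omega>\<in>space M. W \<omega> \<in> ordered_orthant S) \<and>
           (AE \<omega> in M. W (\<theta> \<omega>) = G p (\<sigma> \<omega>) (\<tau> \<omega>) (W \<omega>))"
proof -
  interpret gi_gi_queue M \<theta> \<sigma> \<tau> S p
    using assms unfolding gi_gi_queue_def gi_gi_queue_axioms_def by auto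
  show ?thesis
    using random_vector_W W_in_ordered_orthant AE_W_theta by blast
qed

end
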